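(* Let $X = X(\omega_1)$ be the inverse limit constructed in the context. The nontrivial composant $X - E$ of $X$ is non-metrisable.
   Context: A continuum is a nondegenerate compact connected Hausdorff space; a subcontinuum is a subspace that is itself a continuum. The composant $\kappa(x)$ of a point $x$ of a continuum is the union of all proper subcontinua containing $x$. For points $a,b$ of a continuum, $[a,b]$ denotes the intersection of all subcontinua containing $\{a,b\}$. $\mathbb N = \{1,2,\ldots\}$. Construction of $X$. By transfinite recursion one defines, for each $\alpha \le \omega_1$, a continuum $X(\alpha)$, a point $a_\alpha \in X(\alpha)$, a sequence of points $(q^n_\alpha)_{n \in \mathbb N}$ in $X(\alpha)$, and, for each $\beta \le \alpha$, a continuous map $f^\alpha_\beta : X(\alpha) \to X(\beta)$ (with $f^\alpha_\alpha = \mathrm{id}$) together with an embedding of $X(\beta)$ as a subspace of $X(\alpha)$ for which $f^\alpha_\beta$ is a retraction. Stage $0$: $X(0)$ is the $\sin(1/x)$ continuum $\{(x,\sin(1/x)) : -2/\pi \le x < 0\} \cup (\{0\}\times[-1,1])$, $a_0 = (-2/\pi,-1)$, and $(q^n_0)$ is a chosen sequence of points of the graph $\{(x,\sin(1/x)) : -2/\pi < x < 0\}$ whose $x$-coordinates strictly increase to $0$. Successor stage: let $N = \bigcup_{n \in \mathbb N} \big([a_\beta,q^n_\beta] \times \{1/(2n-1), 1/(2n)\}\big) \cup (X(\beta)\times\{0\}) \subset X(\beta)\times[0,1]$. The space $X(\beta+1)$ is the quotient of $N$ obtained by making, for each $n \in \mathbb N$, the identifications $(q^n_\beta, 1/(2n-1))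 \sim (q^n_\beta,1/(2n))$ and $(a_\beta,1/(2n)) \sim (a_\beta, 1/(2n+1))$. $X(\beta)$ is identified with the subspace $X(\beta)\times\{0\}$; $f^{\beta+1}_\beta$ is induced by the projection $X(\beta)\times[0,1]\to X(\beta)$; $f^{\beta+1}_\gamma = f^\beta_\gamma \circ f^{\beta+1}_\beta$ for $\gamma \le \beta$; $a_{\beta+1}$ is the class of $(a_\beta,1)$; and $q^n_{\beta+1}$ is the class of $(q^n_\beta,1/(2n-1))$. Limit stage ($\alpha \le \omega_1$ a limit ordinal): $X(\alpha) = \varprojlim\{X(\beta); f^\beta_\gamma : \gamma \le \beta < \alpha\}$, the maps $f^\alpha_\beta$ are the projections, $a_\alpha = (a_\beta)_{\beta<\alpha}$, $q^n_\alpha = (q^n_\beta)_{\beta<\alpha}$, and for $\gamma<\alpha$ the space $X(\gamma)$ is identified with the subspace $\{x \in X(\alpha) : x_\beta = x_\gamma \text{ for all } \gamma \le \beta < \alpha\}$ (using $X(\gamma)\subset X(\beta)$). $X = X(\omega_1)$ is an indecomposable continuum with exactly two composants: the trivial composant $E = \bigcup\{X(\alpha) : \alpha<\omega_1\}$ and the nontrivial composant $X - E = \varprojlim\{\kappa(a_\alpha); f^\alpha_\beta : \beta \le \alpha<\omega_1\}$. *)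

theory Defs
  imports "HOL-Analysis.Analysis"
begin

section \<open>The countable ordinals\<close>

text \<open>The initial well-order of cardinality \<open>\<aleph>\<^sub>1\<close>, so the elements of this type are the ordinals
  below \<open>\<omega>\<^sub>1\<close>; see \<open>uncountable_omega1\<close> and \<open>countable_lessThan_omega1\<close> below, which together
  characterise its order type.\<close>

typedef omega1 = "Field (cardSuc natLeq)"
proof -
  have "infinite (Field (cardSuc natLeq))"
    using cardSuc_finite[OF natLeq_Card_order] by (simp add: Field_natLeq)
  then show ?thesis
    by (metis all_not_in_conv finite.emptyI)
qed

lemma wo_cardSuc_natLeq: "Well_order (cardSuc natLeq)"
  using cardSuc_Card_order[OF natLeq_Card_order] by (simp add: card_order_on_def)

instantiation omega1 :: wellorder
begin

definition less_eq_omega1 :: "omega1 \<Rightarrow> omega1 \<Rightarrow> bool"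
  where "a \<le> b \<longleftrightarrow> (Rep_omega1 a, Rep_omega1 b) \<in> cardSuc natLeq"

definition less_omega1 :: "omega1 \<Rightarrow> omega1 \<Rightarrow> bool"
  where "a < b \<longleftrightarrow> a \<le> b \<and> a \<noteq> (b :: omega1)"

instance
proof
  let ?r = "cardSuc natLeq"
  have wo: "wo_rel ?r"
    by (simp add: wo_rel_def wo_cardSuc_natLeq)
  note R = Rep_omega1
  fix x y z :: omega1 and P :: "omega1 \<Rightarrow> bool"
  show refl: "x \<le> x"
    using wo_rel.REFL[OF wo] R[of x] by (auto simp: less_eq_omega1_def refl_on_def)
  show trans: "x \<le> y \<Longrightarrow> y \<le> z \<Longrightarrow> x \<le> z"
    using wo_rel.TRANS[OF wo] by (auto simp: less_eq_omega1_def dest: transD)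
  show anti: "x \<le> y \<Longrightarrow> y \<le> x \<Longrightarrow> x = y" for x y :: omega1
    using wo_rel.ANTISYM[OF wo] by (auto simp: less_eq_omega1_def Rep_omega1_inject dest: antisymD)
  show "x \<le> y \<or> y \<le> x"
    using wo_rel.TOTALS[OF wo] R by (auto simp: less_eq_omega1_def)
  show "x < y \<longleftrightarrow> x \<le> y \<and> \<not> y \<le> x"
    using anti refl by (auto simp: less_omega1_def)
  show "P x" if ind: "\<And>a. (\<And>b. b < a \<Longrightarrow> P b) \<Longrightarrow> P a"
  proof -
    have "wf (inv_image (?r - Id) Rep_omega1)"
      by (intro wf_inv_image wo_rel.WF[OF wo])
    then show ?thesis
    proof (induction x rule: wf_induct_rule)
      case (less x)
      show ?case
        by (rule ind, rule less) (auto simp: less_omega1_def less_eq_omega1_def Rep_omega1_inject)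
    qed
  qed
qed

end

lemma uncountable_omega1: "uncountable (UNIV :: omega1 set)"
  including cardinal_syntax
proof
  let ?F = "Field (cardSuc natLeq)"
  assume "countable (UNIV :: omega1 set)"
  then have "countable (range Rep_omega1)"
    by (rule countable_image)
  then have "countable ?F"
    by (simp add: type_definition.Rep_range[OF type_definition_omega1])
  then obtain f :: "nat set \<Rightarrow> nat" where "inj_on f ?F"
    by (auto simp: countable_def)
  then have "|?F| \<le>o |UNIV :: nat set|"
    by (intro iffD1[OF card_of_ordLeq] exI[of _ f]) simp
  then have "|?F| \<le>o natLeq"
    by (rule ordLeq_ordIso_trans[OF _ card_of_nat])
  then have "cardSuc natLeq \<le>o natLeq"
    by (rule ordIso_ordLeq_trans[OF ordIso_symmetric[OF
          card_of_Field_ordIso[OF cardSuc_Card_order[OF natLeq_Card_order]]]])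
  then show False
    by (rule not_ordLess_ordLeq[OF cardSuc_greater[OF natLeq_Card_order], THEN notE])
qed

lemma countable_lessThan_omega1: "countable {..<\<alpha> :: omega1}"
  including cardinal_syntax
proof -
  let ?r = "cardSuc natLeq"
  have "|underS ?r (Rep_omega1 \<alpha>)| <o ?r"
    by (rule card_of_underS[OF cardSuc_Card_order[OF natLeq_Card_order] Rep_omega1])
  then have "|underS ?r (Rep_omega1 \<alpha>)| \<le>o natLeq"
    by (rule iffD1[OF cardSuc_ordLeq_ordLess[OF natLeq_Card_order card_of_Card_order]])
  then have "|underS ?r (Rep_omega1 \<alpha>)| \<le>o |UNIV :: nat set|"
    by (rule ordLeq_ordIso_trans[OF _ ordIso_symmetric[OF card_of_nat]])
  then have "countable (underS ?r (Rep_omega1 \<alpha>))"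
    unfolding card_of_ordLeq[symmetric] countable_def by blast
  moreover have "Rep_omega1 ` {..<\<alpha>} \<subseteq> underS ?r (Rep_omega1 \<alpha>)"
    by (auto simp: underS_def less_omega1_def less_eq_omega1_def Rep_omega1_inject)
  ultimately have "countable (Rep_omega1 ` {..<\<alpha>})"
    using countable_subset by blast
  then show ?thesis
    by (rule countable_image_inj_on) (simp add: inj_on_def Rep_omega1_inject)
qed

section \<open>Continua and quotients\<close>

definition continuum_space :: "'a topology \<Rightarrow> bool" where
  "continuum_space X \<longleftrightarrow> compact_space X \<and> connected_space X \<and> Hausdorff_space X \<and>
     (\<exists>x \<in> topspace X. \<exists>y \<in> topspace X. x \<noteq> y)"

definition subcontinuum_of :: "'a topology \<Rightarrow> 'a set \<Rightarrow> bool" where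
  "subcontinuum_of X K \<longleftrightarrow> K \<subseteq> topspace X \<and> continuum_space (subtopology X K)"

definition cont_interval :: "'a topology \<Rightarrow> 'a \<Rightarrow> 'a \<Rightarrow> 'a set" where
  "cont_interval X a b = {x \<in> topspace X. \<forall>K. subcontinuum_of X K \<and> a \<in> K \<and> b \<in> K \<longrightarrow> x \<in> K}"

text \<open>The quotient topology on the image of \<open>f\<close>; a homeomorphic copy of \<open>X\<close> if \<open>f\<close> is injective.\<close>

definition quotient_top :: "'a topology \<Rightarrow> ('a \<Rightarrow> 'b) \<Rightarrow> 'b topology" where
  "quotient_top X f =
     topology (\<lambda>U. U \<subseteq> f ` topspace X \<and> openin X {x \<in> topspace X. f x \<in> U})"

lemma openin_quotient_top:
  "openin (quotient_top X f) U \<longleftrightarrow> U \<subseteq> f ` topspace X \<and> openin X {x \<in> topspace X. f x \<in> U}"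
proof -
  have "istopology (\<lambda>U. U \<subseteq> f ` topspace X \<and> openin X {x \<in> topspace X. f x \<in> U})"
    unfolding istopology_def
  proof (intro conjI allI impI; (elim conjE)?)
    fix S T
    assume "openin X {x \<in> topspace X. f x \<in> S}" "openin X {x \<in> topspace X. f x \<in> T}"
    then have "openin X ({x \<in> topspace X. f x \<in> S} \<inter> {x \<in> topspace X. f x \<in> T})"
      by (rule openin_Int)
    then show "openin X {x \<in> topspace X. f x \<in> S \<inter> T}"
      by (rule back_subst) auto
  next
    fix \<K>
    assume "\<forall>K\<in>\<K>. K \<subseteq> f ` topspace X \<and> openin X {x \<in> topspace X. f x \<in> K}"
    then have "openin X (\<Union>K\<in>\<K>. {x \<in> topspace X. f x \<in> K})"
      by blast
    then show "openin X {x \<in> topspace X. f x \<in> \<Union> \<K>}"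
      by (rule back_subst) auto
  qed auto
  then show ?thesis
    by (simp add: quotient_top_def)
qed

lemma topspace_quotient_top: "topspace (quotient_top X f) = f ` topspace X"
proof
  show "topspace (quotient_top X f) \<subseteq> f ` topspace X"
    by (auto simp: topspace_def openin_quotient_top)
  have "{x \<in> topspace X. f x \<in> f ` topspace X} = topspace X"
    by auto
  then have "openin (quotient_top X f) (f ` topspace X)"
    by (simp add: openin_quotient_top)
  then show "f ` topspace X \<subseteq> topspace (quotient_top X f)"
    by (rule openin_subset)
qed

lemma quotient_map_quotient_top: "quotient_map X (quotient_top X f) f"
  by (auto simp: quotient_map_def topspace_quotient_top openin_quotient_top)

section \<open>The transfinite construction\<close>

text \<open>A common type for the points of all stages: points of the plane, representatives in
  \<open>X(\<beta>) \<times> [0,1]\<close> of the classes of a successor stage, and threads of a limit stage.\<close>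

datatype point =
    Plane "real \<times> real"
  | Class (rep: "point \<times> real")
  | Thread (coord: "omega1 \<Rightarrow> point")

text \<open>The data at stage \<open>\<alpha>\<close>: the space \<open>X(\<alpha>)\<close>, the point \<open>a\<^sub>\<alpha>\<close>, the sequence \<open>q\<^sub>\<alpha>\<close> (only indices
  \<open>n \<ge> 1\<close> matter), and for \<open>\<beta> \<le> \<alpha>\<close> the map \<open>f\<close> from \<open>X(\<alpha>)\<close> to \<open>X(\<beta>)\<close> and the embedding
  of \<open>X(\<beta>)\<close> into \<open>X(\<alpha>)\<close>. Values of the last two at \<open>\<beta> > \<alpha>\<close> are irrelevant.\<close>

record stage =
  stage_space :: "point topology"
  stage_a :: point
  stage_q :: "nat \<Rightarrow> point"
  bonding :: "omega1 \<Rightarrow> point \<Rightarrow> point"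
  embed :: "omega1 \<Rightarrow> point \<Rightarrow> point"

definition sin_graph :: "(real \<times> real) set" where
  "sin_graph = {(x, sin (1 / x)) | x. -2 / pi < x \<and> x < 0}"

definition sin_continuum :: "(real \<times> real) set" where
  "sin_continuum = {(x, sin (1 / x)) | x. -2 / pi \<le> x \<and> x < 0} \<union> {0} \<times> {-1..1}"

definition zero_stage :: "(nat \<Rightarrow> real \<times> real) \<Rightarrow> stage" where
  "zero_stage q0 =
    \<lparr> stage_space = quotient_top (top_of_set sin_continuum) Plane,
      stage_a = Plane (-2 / pi, -1),
      stage_q = (\<lambda>n. Plane (q0 n)),
      bonding = (\<lambda>\<gamma> x. x),
      embed = (\<lambda>\<gamma> x. x) \<rparr>"

definition zigzag :: "point topology \<Rightarrow> point \<Rightarrow> (nat \<Rightarrow> point) \<Rightarrow> (point \<times> real) set" where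
  "zigzag X a q =
     (\<Union>n\<in>{1..}. cont_interval X a (q n) \<times> {1 / (2 * real n - 1), 1 / (2 * real n)})
     \<union> topspace X \<times> {0}"

definition glue :: "point \<Rightarrow> (nat \<Rightarrow> point) \<Rightarrow> ((point \<times> real) \<times> (point \<times> real)) set" where
  "glue a q =
     {((q n, 1 / (2 * real n - 1)), (q n, 1 / (2 * real n))) | n. 1 \<le> n}
     \<union> {((a, 1 / (2 * real n)), (a, 1 / (2 * real n + 1))) | n. 1 \<le> n}"

text \<open>The quotient map by the equivalence relation generated by \<open>glue\<close>. A class is named by a chosen
  representative, so two points have the same image iff they are equivalent.\<close>

definition glue_class :: "point \<Rightarrow> (nat \<Rightarrow> point) \<Rightarrow> point \<times> real \<Rightarrow> point" where
  "glue_class a q p = Class (SOME p'. (p, p') \<in> (glue a q \<union> (glue a q)\<inverse>)\<^sup>*)"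

text \<open>Stage \<open>\<beta> + 1\<close> from stage \<open>\<beta>\<close>. All points of a class have the same first component, so
  \<open>fst \<circ> rep\<close> is the map induced by the projection.\<close>

definition succ_stage :: "omega1 \<Rightarrow> stage \<Rightarrow> stage" where
  "succ_stage \<beta> S =
    (let X = stage_space S; a = stage_a S; q = stage_q S; cls = glue_class a q in
    \<lparr> stage_space =
        quotient_top (subtopology (prod_topology X (top_of_set {0..1})) (zigzag X a q)) cls,
      stage_a = cls (a, 1),
      stage_q = (\<lambda>n. cls (q n, 1 / (2 * real n - 1))),
      bonding = (\<lambda>\<gamma> p. if \<gamma> \<le> \<beta> then bonding S \<gamma> (fst (rep p)) else p),
      embed = (\<lambda>\<gamma> p. if \<gamma> \<le> \<beta> then cls (embed S \<gamma> p, 0) else p) \<rparr>)"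

definition threads :: "omega1 set \<Rightarrow> (omega1 \<Rightarrow> stage) \<Rightarrow> (omega1 \<Rightarrow> point) set" where
  "threads I S = {x \<in> \<Pi>\<^sub>E \<beta>\<in>I. topspace (stage_space (S \<beta>)).
     \<forall>\<beta>\<in>I. \<forall>\<gamma>\<in>I. \<gamma> \<le> \<beta> \<longrightarrow> bonding (S \<beta>) \<gamma> (x \<beta>) = x \<gamma>}"

text \<open>The inverse limit of the stages with index in \<open>I\<close>; here \<open>I\<close> is \<open>{..<\<alpha>}\<close> for a limit \<open>\<alpha>\<close>, or
  \<open>UNIV\<close> for the limit \<open>\<omega>\<^sub>1\<close> itself.\<close>

definition limit_stage :: "omega1 set \<Rightarrow> (omega1 \<Rightarrow> stage) \<Rightarrow> stage" where
  "limit_stage I S =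
    \<lparr> stage_space =
        quotient_top (subtopology (product_topology (\<lambda>\<beta>. stage_space (S \<beta>)) I) (threads I S)) Thread,
      stage_a = Thread (\<lambda>\<beta>\<in>I. stage_a (S \<beta>)),
      stage_q = (\<lambda>n. Thread (\<lambda>\<beta>\<in>I. stage_q (S \<beta>) n)),
      bonding = (\<lambda>\<gamma> p. if \<gamma> \<in> I then coord p \<gamma> else p),
      embed = (\<lambda>\<gamma> p. if \<gamma> \<in> I
        then Thread (\<lambda>\<beta>\<in>I. if \<gamma> \<le> \<beta> then embed (S \<beta>) \<gamma> p else bonding (S \<gamma>) \<beta> p)
        else p) \<rparr>"

lemma limit_stage_cong [fundef_cong]:
  assumes "I = J" "\<And>\<beta>. \<beta> \<in> J \<Longrightarrow> S \<beta> = T \<beta>"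
  shows "limit_stage I S = limit_stage J T"
proof -
  have "(\<Pi>\<^sub>E \<beta>\<in>J. topspace (stage_space (S \<beta>))) = (\<Pi>\<^sub>E \<beta>\<in>J. topspace (stage_space (T \<beta>)))"
    using assms(2) by (intro PiE_cong) simp
  moreover have "(\<lambda>F. \<exists>i U. F = {f. f i \<in> U} \<and> i \<in> J \<and> openin (stage_space (S i)) U) =
      (\<lambda>F. \<exists>i U. F = {f. f i \<in> U} \<and> i \<in> J \<and> openin (stage_space (T i)) U)"
    using assms(2) by (auto cong: conj_cong)
  ultimately have "product_topology (\<lambda>\<beta>. stage_space (S \<beta>)) J =
      product_topology (\<lambda>\<beta>. stage_space (T \<beta>)) J"
    unfolding openin_inject[symmetric] openin_product_topology topspace_product_topology by simp
  moreover have "threads J S = threads J T"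
    unfolding threads_def using assms(2) by (auto simp: PiE_iff)
  ultimately show ?thesis
    unfolding limit_stage_def using assms by (auto simp: fun_eq_iff)
qed

definition is_succ :: "omega1 \<Rightarrow> omega1 \<Rightarrow> bool" where
  "is_succ \<beta> \<alpha> \<longleftrightarrow> \<beta> < \<alpha> \<and> \<not> (\<exists>\<gamma>. \<beta> < \<gamma> \<and> \<gamma> < \<alpha>)"

lemma the_is_succ:
  assumes "is_succ \<beta> \<alpha>"
  shows "(THE \<beta>. is_succ \<beta> \<alpha>) = \<beta>"
  using assms unfolding is_succ_def by (intro the_equality) (blast, metis linorder_neqE)

function stage_at :: "(nat \<Rightarrow> real \<times> real) \<Rightarrow> omega1 \<Rightarrow> stage" where
  "stage_at q0 \<alpha> =
    (if \<forall>\<beta>. \<alpha> \<le> \<beta> then zero_stage q0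
     else if \<exists>\<beta>. is_succ \<beta> \<alpha>
       then succ_stage (THE \<beta>. is_succ \<beta> \<alpha>) (stage_at q0 (THE \<beta>. is_succ \<beta> \<alpha>))
     else limit_stage {..<\<alpha>} (stage_at q0))"
  by pat_completeness auto
termination
proof (relation "inv_image {(\<beta>, \<alpha> :: omega1). \<beta> < \<alpha>} snd")
  show "wf (inv_image {(\<beta>, \<alpha> :: omega1). \<beta> < \<alpha>} snd)"
    by (intro wf_inv_image wellorder_class.wf)
qed (auto simp: the_is_succ is_succ_def[THEN iffD1])

declare stage_at.simps [simp del]

definition final_stage :: "(nat \<Rightarrow> real \<times> real) \<Rightarrow> stage" where
  "final_stage q0 = limit_stage UNIV (stage_at q0)"

text \<open>The space \<open>X = X(\<omega>\<^sub>1)\<close> and its trivial composant \<open>E\<close>, the union of all \<open>X(\<alpha>)\<close> with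
  \<open>\<alpha> < \<omega>\<^sub>1\<close>, regarded as subspaces of \<open>X\<close>.\<close>

definition X_omega1 :: "(nat \<Rightarrow> real \<times> real) \<Rightarrow> point topology" where
  "X_omega1 q0 = stage_space (final_stage q0)"

definition trivial_composant :: "(nat \<Rightarrow> real \<times> real) \<Rightarrow> point set" where
  "trivial_composant q0 =
     (\<Union>\<alpha>. embed (final_stage q0) \<alpha> ` topspace (stage_space (stage_at q0 \<alpha>)))"

end

theory Submission
  imports Defs
begin

text \<open>
  A basic neighbourhood of a thread of \<open>X\<close> constrains only finitely many coordinates. If \<open>X - E\<close> were
  metrisable, the balls of radius \<open>1/k\<close> around one of its points \<open>y\<close> would together constrain only
  countably many coordinates, all of them at most some \<open>\<delta> < \<omega>\<^sub>1\<close>, and \<open>y\<close> would be the only point of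
  \<open>X - E\<close> with these coordinates (\<open>countable_coords_if_metrizable\<close>). The proof exhibits a point \<open>y\<close> and,
  for every \<open>\<delta>\<close>, a point \<open>w \<noteq> y\<close> of \<open>X - E\<close> that agrees with \<open>y\<close> up to \<open>\<delta>\<close>.

  A point \<open>x\<close> of \<open>[a\<^sub>\<beta>, q\<^sub>\<beta>\<^sup>n]\<close> has two lifts to \<open>X(\<beta> + 1)\<close> in the copies of that interval, \<open>(x, 1/(2n-1))\<close>
  and \<open>(x, 1/(2n))\<close>. The point \<open>y\<close> starts from a point strictly inside \<open>[a\<^sub>0, q\<^sub>0\<^sup>1]\<close> and always uses level
  \<open>1\<close>; the point \<open>w\<close> follows \<open>y\<close> below \<open>\<delta>\<close>, uses level \<open>1/2\<close> at \<open>\<delta>\<close>, and level \<open>1/3\<close> from then on. A thread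
  that always uses positive levels avoids \<open>E\<close>, since a point of \<open>E\<close> eventually uses level \<open>0\<close>
  (\<open>lift_notin_trivial_composant\<close>).

  The recursion can only be continued if the lifted point lies in an interval \<open>[a, q\<^sup>n]\<close> of the new
  stage (\<open>lift_interior_at\<close>). At a successor stage this follows from a map that collapses
  everything before and after one level of the zigzag to the two ends of that level: it carries a
  continuum through the ends of the zigzag to a continuum in \<open>X(\<beta>)\<close> through \<open>a\<^sub>\<beta>\<close> and \<open>q\<^sub>\<beta>\<^sup>n\<close>, and it is
  injective over points other than these two (\<open>cls_in_succ_cont_interval\<close>). At a limit stage it follows from
  compactness of the continuum (\<open>Thread_in_limit_cont_interval\<close>). The ends \<open>a\<close> and \<open>q\<^sup>n\<close> are excluded
  because the collapsing maps are not injective there, and the lifted point is again distinct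
  from the ends, so the induction carries itself.
\<close>

section \<open>Separating maps and images of continua\<close>

lemma Hausdorff_space_separating_maps:
  fixes X :: "'a topology"
  assumes "\<And>x y. \<lbrakk>x \<in> topspace X; y \<in> topspace X; x \<noteq> y\<rbrakk>
    \<Longrightarrow> \<exists>(Y :: 'b topology) f. Hausdorff_space Y \<and> continuous_map X Y f \<and> f x \<noteq> f y"
  shows "Hausdorff_space X"
  unfolding Hausdorff_space_def
proof (intro allI impI, elim conjE)
  fix x y
  assume xy: "x \<in> topspace X" "y \<in> topspace X" "x \<noteq> y"
  then obtain Y :: "'b topology" and f
    where Y: "Hausdorff_space Y" and f: "continuous_map X Y f" and ne: "f x \<noteq> f y"
    using assms by blast
  have "f x \<in> topspace Y" "f y \<in> topspace Y"
    using continuous_map_image_subset_topspace[OF f] xy by auto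
  then obtain U V where UV: "openin Y U" "openin Y V" "f x \<in> U" "f y \<in> V" "disjnt U V"
    using Y ne unfolding Hausdorff_space_def by metis
  let ?U = "{z \<in> topspace X. f z \<in> U}" and ?V = "{z \<in> topspace X. f z \<in> V}"
  have "openin X ?U" "openin X ?V"
    using f UV openin_continuous_map_preimage by blast+
  moreover have "x \<in> ?U" "y \<in> ?V" "disjnt ?U ?V"
    using xy UV by (auto simp: disjnt_iff)
  ultimately show "\<exists>U V. openin X U \<and> openin X V \<and> x \<in> U \<and> y \<in> V \<and> disjnt U V"
    by blast
qed

lemma subcontinuum_of_image:
  assumes K: "subcontinuum_of X K" and f: "continuous_map X Y f" and Y: "Hausdorff_space Y"
    and xy: "x \<in> f ` K" "y \<in> f ` K" "x \<noteq> y"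
  shows "subcontinuum_of Y (f ` K)"
proof -
  have "compactin X K" "connectedin X K"
    using K by (auto simp: subcontinuum_of_def continuum_space_def compactin_subspace connectedin_def)
  then have "compactin Y (f ` K)" "connectedin Y (f ` K)"
    using f by (auto intro: image_compactin connectedin_continuous_map_image)
  moreover from this have "topspace (subtopology Y (f ` K)) = f ` K"
    by (auto simp: compactin_subspace)
  ultimately show ?thesis
    using Y xy unfolding subcontinuum_of_def continuum_space_def
    by (auto simp: compactin_subspace connectedin_def Hausdorff_space_subtopology)
qed

lemma cont_interval_continuous_image:
  assumes K: "subcontinuum_of X K" and f: "continuous_map X Y f" and Y: "Hausdorff_space Y"
    and ab: "a \<in> f ` K" "b \<in> f ` K" "a \<noteq> b" and x: "x \<in> cont_interval Y a b"
  shows "x \<in> f ` K"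
  using subcontinuum_of_image[OF K f Y ab] x ab unfolding cont_interval_def by blast

lemma cont_interval_ends:
  assumes "a \<in> topspace X" "b \<in> topspace X"
  shows "a \<in> cont_interval X a b" "b \<in> cont_interval X a b"
  using assms by (auto simp: cont_interval_def)

section \<open>One successor stage\<close>

text \<open>The relation generated by \<open>glue\<close> is never computed; classes are compared only through
  functions that \<open>glue\<close> preserves.\<close>

lemma glue_invariant_rep:
  assumes "\<And>r r'. (r, r') \<in> glue a q \<Longrightarrow> g r = g r'"
  shows "g (rep (glue_class a q p)) = g p"
proof -
  have "(p, rep (glue_class a q p)) \<in> (glue a q \<union> (glue a q)\<inverse>)\<^sup>*"
    unfolding glue_class_def point.sel by (rule someI[of _ p]) simp
  then show ?thesis
    by (induction rule: rtrancl_induct) (auto dest: assms)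
qed

lemma fst_rep_glue_class: "fst (rep (glue_class a q p)) = fst p"
  by (rule glue_invariant_rep[of _ _ fst]) (auto simp: glue_def)

lemma snd_rep_glue_class_eq_0_iff: "snd (rep (glue_class a q p)) = 0 \<longleftrightarrow> snd p = 0"
  by (rule glue_invariant_rep[of _ _ "\<lambda>p. snd p = 0"]) (auto simp: glue_def)

lemma glue_class_eqI:
  assumes "(p, p') \<in> glue a q"
  shows "glue_class a q p = glue_class a q p'"
proof -
  let ?R = "(glue a q \<union> (glue a q)\<inverse>)\<^sup>*"
  have "(p, p') \<in> ?R" "(p', p) \<in> ?R"
    using assms by auto
  then have "(p, r) \<in> ?R \<longleftrightarrow> (p', r) \<in> ?R" for r
    by (meson rtrancl_trans)
  then show ?thesis
    by (simp add: glue_class_def)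
qed

text \<open>What has to survive from stage to stage. Hausdorffness is part of the induction because a subspace
  is a subcontinuum only if it is Hausdorff, so images of continua are continua only in Hausdorff spaces.\<close>

locale marked_space =
  fixes X :: "point topology" and a :: point and q :: "nat \<Rightarrow> point"
  assumes Hausdorff: "Hausdorff_space X"
    and a_in: "a \<in> topspace X"
    and q_in: "\<And>n. 1 \<le> n \<Longrightarrow> q n \<in> topspace X"
    and a_neq_q: "\<And>n. 1 \<le> n \<Longrightarrow> a \<noteq> q n"
begin

text \<open>The ends of the levels in the order in which the zigzag runs through them: \<open>a, q\<^sup>1, a, q\<^sup>2, a, \<dots>\<close>. With
  levels numbered by the \<open>m\<close> in \<open>1/m\<close>, level \<open>m\<close> is a copy of \<open>[a, q\<^sup>n]\<close> with \<open>n = (m + 1) div 2\<close>, it runs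
  from \<open>node (m - 1)\<close> to \<open>node m\<close>, and it is glued at \<open>node m\<close> to level \<open>m + 1\<close>. This makes odd and
  even levels instances of one case.\<close>

definition node :: "nat \<Rightarrow> point" where
  "node m = (if even m then a else q ((m + 1) div 2))"

lemma node_in: "node m \<in> topspace X"
  using a_in q_in by (auto simp: node_def elim!: oddE)

lemma node_Suc_neq: "node (Suc m) \<noteq> node m"
  using a_neq_q[of "(m + 1) div 2"] a_neq_q[of "(m + 2) div 2"]
  by (auto simp: node_def elim!: oddE evenE)

lemma glue_eq:
  "glue a q = {((node m, 1 / real m), (node m, 1 / real (Suc m))) | m. 1 \<le> m}" (is "_ = ?R")
proof (intro equalityI subsetI)
  fix z
  assume "z \<in> glue a q"
  then consider n where "1 \<le> n" "z = ((q n, 1 / (2 * real n - 1)), (q n, 1 / (2 * real n)))"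
    | n where "1 \<le> n" "z = ((a, 1 / (2 * real n)), (a, 1 / (2 * real n + 1)))"
    unfolding glue_def by blast
  then show "z \<in> ?R"
  proof cases
    case 1
    then have "z = ((node (2 * n - 1), 1 / real (2 * n - 1)), (node (2 * n - 1), 1 / real (Suc (2 * n - 1))))"
      by (simp add: node_def of_nat_diff)
    then show ?thesis
      using 1 by (intro CollectI exI[of _ "2 * n - 1"]) simp
  next
    case 2
    then show ?thesis
      by (intro CollectI exI[of _ "2 * n"]) (simp add: node_def add.commute)
  qed
next
  fix z
  assume "z \<in> ?R"
  then obtain m where m: "1 \<le> m" "z = ((node m, 1 / real m), (node m, 1 / real (Suc m)))"
    by blast
  show "z \<in> glue a q"
  proof (cases "even m")
    case True
    then obtain n where "m = 2 * n"
      by (elim evenE)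
    then show ?thesis
      using m unfolding glue_def
      by (intro UnI2 CollectI exI[of _ n]) (simp add: node_def add.commute)
  next
    case False
    then obtain n where "m = 2 * n + 1"
      by (elim oddE)
    then show ?thesis
      using m unfolding glue_def
      by (intro UnI1 CollectI exI[of _ "n + 1"]) (simp add: node_def add.commute)
  qed
qed

lemma zigzag_iff:
  "(x, t) \<in> zigzag X a q \<longleftrightarrow> t = 0 \<and> x \<in> topspace X \<or>
     (\<exists>m\<ge>1. t = 1 / real m \<and> x \<in> cont_interval X a (q ((m + 1) div 2)))" (is "?l \<longleftrightarrow> ?r")
proof
  assume ?l
  then consider "t = 0" "x \<in> topspace X"
    | n where "1 \<le> n" "t = 1 / (2 * real n - 1)" "x \<in> cont_interval X a (q n)"
    | n where "1 \<le> n" "t = 1 / (2 * real n)" "x \<in> cont_interval X a (q n)"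
    unfolding zigzag_def by auto
  then show ?r
  proof cases
    case 2
    then show ?thesis
      by (intro disjI2 exI[of _ "2 * n - 1"]) (simp add: of_nat_diff)
  next
    case 3
    then show ?thesis
      by (intro disjI2 exI[of _ "2 * n"]) simp
  qed simp
next
  assume ?r
  then consider "t = 0" "x \<in> topspace X"
    | m where "1 \<le> m" "t = 1 / real m" "x \<in> cont_interval X a (q ((m + 1) div 2))"
    by blast
  then show ?l
  proof cases
    case 1
    then show ?thesis
      by (simp add: zigzag_def)
  next
    case 2
    then have "real m = 2 * real ((m + 1) div 2) - 1 \<or> real m = 2 * real ((m + 1) div 2)"
      by (cases "even m") (auto elim!: evenE oddE)
    then have "t \<in> {1 / (2 * real ((m + 1) div 2) - 1), 1 / (2 * real ((m + 1) div 2))}"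
      using 2 by auto
    then show ?thesis
      using 2 unfolding zigzag_def by (intro UnI1 UN_I[of "(m + 1) div 2"]) auto
  qed
qed

lemma zigzag_subset: "zigzag X a q \<subseteq> topspace X \<times> {0..1}"
  by (auto simp: zigzag_iff cont_interval_def)

abbreviation N :: "(point \<times> real) topology" where
  "N \<equiv> subtopology (prod_topology X (top_of_set {0..1})) (zigzag X a q)"

abbreviation cls :: "point \<times> real \<Rightarrow> point" where
  "cls \<equiv> glue_class a q"

abbreviation succ_space :: "point topology" where
  "succ_space \<equiv> quotient_top N cls"

lemma topspace_N: "topspace N = zigzag X a q"
  using zigzag_subset by (simp add: topspace_subtopology inf_absorb2)

lemma topspace_succ_space: "topspace succ_space = cls ` zigzag X a q"
  by (simp add: topspace_quotient_top topspace_N del: topspace_subtopology)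

text \<open>Retracts the zigzag onto level \<open>m\<close>, read as a map to \<open>X\<close>: all levels before it go to its first end,
  all levels after it, and \<open>X \<times> {0}\<close>, to its last end.\<close>

definition collapse :: "nat \<Rightarrow> point \<times> real \<Rightarrow> point" where
  "collapse m = (\<lambda>(x, t). if 1 / real m < t then node (m - 1) else if t = 1 / real m then x else node m)"

lemma collapse_level [simp]:
  assumes "1 \<le> m" "1 \<le> k"
  shows "collapse m (x, 1 / real k) = (if k < m then node (m - 1) else if k = m then x else node m)"
  using assms by (auto simp: collapse_def field_simps)

lemma collapse_glue:
  assumes "1 \<le> m" "(r, r') \<in> glue a q"
  shows "collapse m r = collapse m r'"
proof -
  obtain k where k: "1 \<le> k" "r = (node k, 1 / real k)" "r' = (node k, 1 / real (Suc k))"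
    using assms(2) by (auto simp: glue_eq)
  then show ?thesis
    using assms(1) collapse_level[of m k] collapse_level[of m "Suc k"]
    by (auto simp del: of_nat_Suc)
qed

lemma collapse_rep_cls:
  "1 \<le> m \<Longrightarrow> collapse m (rep (cls p)) = collapse m p"
  by (intro glue_invariant_rep[of _ _ "collapse m"] collapse_glue)

lemma continuous_map_snd_N: "continuous_map N euclideanreal snd"
  by (metis continuous_map_from_subtopology continuous_map_into_fulltopology continuous_map_snd)

lemma continuous_map_fst_N: "continuous_map N X fst"
  by (metis continuous_map_from_subtopology continuous_map_fst)

text \<open>No other level accumulates at \<open>1/m > 0\<close>, so the parts above, on and below level \<open>m\<close> are open in the
  zigzag; the map is constant on two of them and the projection on the third.\<close>

lemma continuous_map_collapse:
  assumes m: "1 \<le> m"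
  shows "continuous_map N X (collapse m)"
proof -
  \<comment> \<open>The open interval between the neighbouring levels; \<open>(m - 1) * t < 1\<close> stands for \<open>t < 1/(m - 1)\<close>,
    which in this form is also right for \<open>m = 1\<close>.\<close>
  define T :: "nat \<Rightarrow> (point \<times> real) set" where
    "T i = {p \<in> topspace N. snd p \<in>
       (if i = 0 then {1 / real m <..} else if i = 1 then {..<1 / real m}
        else {1 / real (Suc m) <..} \<inter> {t. real (m - 1) * t < 1})}" for i
  define g :: "nat \<Rightarrow> point \<times> real \<Rightarrow> point" where
    "g i = (if i = 0 then (\<lambda>_. node (m - 1)) else if i = 1 then (\<lambda>_. node m) else fst)" for i
  have level: "snd p = 1 / real m" if "p \<in> T 2" for p
  proof -
    have p: "(fst p, snd p) \<in> zigzag X a q"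
      using that by (simp add: T_def topspace_N del: topspace_subtopology)
    have gt: "1 / real (Suc m) < snd p" and lt: "real (m - 1) * snd p < 1"
      using that by (auto simp: T_def)
    have "0 < 1 / real (Suc m)"
      by simp
    with gt have "snd p \<noteq> 0"
      by linarith
    with p obtain k where k: "1 \<le> k" "snd p = 1 / real k"
      unfolding zigzag_iff by blast
    have "k < Suc m"
      using gt k by (simp add: field_simps del: of_nat_Suc)
    moreover have "m - 1 < k"
      using lt k by (simp add: field_simps)
    ultimately have "k = m"
      by simp
    with k show ?thesis
      by simp
  qed
  show ?thesis
  proof (rule pasting_lemma[where I = "{0, 1, 2}" and T = T and f = g])
    fix i :: nat
    have "open {t. real (m - 1) * t < 1}"
      by (intro open_Collect_less continuous_intros)
    then show "openin N (T i)"
      unfolding T_def by (intro openin_continuous_map_preimage[OF continuous_map_snd_N]) auto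
    show "continuous_map (subtopology N (T i)) X (g i)"
      using node_in continuous_map_fst_N by (auto simp: g_def continuous_map_from_subtopology)
  next
    fix i j :: nat and p
    assume ij: "i \<in> {0, 1, 2}" "j \<in> {0, 1, 2}" and p: "p \<in> topspace N \<inter> T i \<inter> T j"
    have "p \<in> T 0 \<Longrightarrow> 1 / real m < snd p" "p \<in> T 1 \<Longrightarrow> snd p < 1 / real m"
      by (simp_all add: T_def)
    with level[of p] have "p \<notin> T 0 \<inter> T 1" "p \<notin> T 0 \<inter> T 2" "p \<notin> T 1 \<inter> T 2"
      by auto
    with ij p have "i = j"
      by auto
    then show "g i p = g j p"
      by simp
  next
    fix p
    assume p: "p \<in> topspace N"
    consider "1 / real m < snd p" | "snd p < 1 / real m" | "snd p = 1 / real m"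
      by linarith
    then show "\<exists>j. j \<in> {0, 1, 2} \<and> p \<in> T j \<and> collapse m p = g j p"
    proof cases
      case 1
      then show ?thesis
        using p by (intro exI[of _ 0]) (auto simp: T_def g_def collapse_def split: prod.splits)
    next
      case 2
      then show ?thesis
        using p by (intro exI[of _ 1]) (auto simp: T_def g_def collapse_def split: prod.splits)
    next
      case 3
      have "1 / real (Suc m) < 1 / real m" "real (m - 1) * (1 / real m) < 1"
        using m by (auto simp: field_simps of_nat_diff)
      then show ?thesis
        using p 3 by (intro exI[of _ 2]) (auto simp: T_def g_def collapse_def split: prod.splits)
    qed
  qed
qed

lemma continuous_map_succ_space:
  assumes "continuous_map N X g" "\<And>p. g (rep (cls p)) = g p"
  shows "continuous_map succ_space X (\<lambda>x. g (rep x))"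
proof (rule continuous_compose_quotient_map[OF quotient_map_quotient_top])
  have "(\<lambda>x. g (rep x)) \<circ> cls = g"
    using assms(2) by auto
  then show "continuous_map N X ((\<lambda>x. g (rep x)) \<circ> cls)"
    using assms(1) by simp
qed

text \<open>The collapsing maps see every difference between levels that gluing leaves. If \<open>(x, s)\<close> and \<open>(x, t)\<close>
  with \<open>t < s = 1/m\<close> agree under \<open>collapse m\<close>, then \<open>x = node m\<close>, where level \<open>m\<close> is glued to level
  \<open>m + 1\<close>; a still lower \<open>t\<close> would make \<open>collapse (m + 1)\<close> equate \<open>node m\<close> with \<open>node (m + 1)\<close>, that is,
  \<open>a\<close> with a \<open>q\<^sup>n\<close>.\<close>

lemma cls_eq_if_collapse_eq:
  assumes p: "(x, s) \<in> zigzag X a q" and p': "(x, t) \<in> zigzag X a q"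
    and eq: "\<And>m. 1 \<le> m \<Longrightarrow> collapse m (x, s) = collapse m (x, t)"
  shows "cls (x, s) = cls (x, t)"
proof -
  have *: "cls (x, s) = cls (x, t)"
    if p: "(x, s) \<in> zigzag X a q" and p': "(x, t) \<in> zigzag X a q"
      and eq: "\<And>m. 1 \<le> m \<Longrightarrow> collapse m (x, s) = collapse m (x, t)" and ts: "t < s" for s t
  proof -
    have "0 \<le> t"
      using p' zigzag_subset by auto
    with ts p obtain m where m: "1 \<le> m" "s = 1 / real m"
      unfolding zigzag_iff by auto
    have x: "x = node m"
      using eq[OF m(1)] ts by (simp add: collapse_def m split: if_splits)
    then have glued: "cls (x, s) = cls (x, 1 / real (Suc m))"
      using m by (intro glue_class_eqI) (auto simp: glue_eq)
    have "\<not> 1 / real (Suc m) < t"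
    proof
      assume *: "1 / real (Suc m) < t"
      moreover have "0 < 1 / real (Suc m)"
        by simp
      ultimately have "t \<noteq> 0"
        by linarith
      then obtain k where k: "1 \<le> k" "t = 1 / real k"
        using p' unfolding zigzag_iff by blast
      have "k < Suc m" "m < k"
        using * ts m k by (simp_all add: field_simps del: of_nat_Suc)
      then show False
        by simp
    qed
    moreover have "\<not> t < 1 / real (Suc m)"
    proof
      assume *: "t < 1 / real (Suc m)"
      have "collapse (Suc m) (x, s) = node m"
        using m collapse_level[of "Suc m" m x] by simp
      moreover have "collapse (Suc m) (x, t) = node (Suc m)"
        using * by (simp add: collapse_def)
      ultimately show False
        using eq[of "Suc m"] node_Suc_neq[of m] by simp
    qed
    ultimately show ?thesis
      using glued by (simp add: not_less order_antisym)
  qed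
  show ?thesis
  proof (cases s t rule: linorder_cases)
    case less
    then show ?thesis
      using *[of t s] p p' eq by metis
  next
    case greater
    then show ?thesis
      using *[of s t] p p' eq by metis
  qed simp
qed

lemma Hausdorff_succ_space: "Hausdorff_space succ_space"
proof (rule Hausdorff_space_separating_maps)
  fix c c'
  assume "c \<in> topspace succ_space" "c' \<in> topspace succ_space" and ne: "c \<noteq> c'"
  then obtain x s x' t where p: "(x, s) \<in> zigzag X a q" "c = cls (x, s)"
    and p': "(x', t) \<in> zigzag X a q" "c' = cls (x', t)"
    unfolding topspace_succ_space by (metis (no_types, lifting) imageE surj_pair)
  show "\<exists>(Y :: point topology) f. Hausdorff_space Y \<and> continuous_map succ_space Y f \<and> f c \<noteq> f c'"
  proof (cases "x = x'")
    case False
    have "continuous_map succ_space X (\<lambda>x. fst (rep x))"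
      by (intro continuous_map_succ_space continuous_map_fst_N fst_rep_glue_class)
    moreover have "fst (rep c) \<noteq> fst (rep c')"
      using False p p' by (simp add: fst_rep_glue_class)
    ultimately show ?thesis
      using Hausdorff by blast
  next
    case True
    then obtain m where m: "1 \<le> m" "collapse m (x, s) \<noteq> collapse m (x', t)"
      using cls_eq_if_collapse_eq p p' ne by metis
    have "continuous_map succ_space X (\<lambda>x. collapse m (rep x))"
      using m by (intro continuous_map_succ_space continuous_map_collapse collapse_rep_cls)
    moreover have "collapse m (rep c) \<noteq> collapse m (rep c')"
      using m p p' by (simp add: collapse_rep_cls)
    ultimately show ?thesis
      using Hausdorff by blast
  qed
qed

lemma succ_cls_in:
  assumes "1 \<le> m" "x \<in> cont_interval X a (q ((m + 1) div 2))"
  shows "cls (x, 1 / real m) \<in> topspace succ_space"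
  using assms unfolding topspace_succ_space by (intro imageI) (auto simp: zigzag_iff)

lemma succ_a_in: "cls (a, 1) \<in> topspace succ_space"
  using succ_cls_in[of 1 a] cont_interval_ends[OF a_in q_in[of 1]] by simp

lemma succ_q_in:
  assumes "1 \<le> n"
  shows "cls (q n, 1 / (2 * real n - 1)) \<in> topspace succ_space"
  using succ_cls_in[of "2 * n - 1" "q n"] cont_interval_ends[OF a_in q_in[OF assms]] assms
  by (simp add: of_nat_diff)

lemma marked_space_succ:
  "marked_space succ_space (cls (a, 1)) (\<lambda>n. cls (q n, 1 / (2 * real n - 1)))"
proof
  fix n :: nat
  assume "1 \<le> n"
  then show "cls (a, 1) \<noteq> cls (q n, 1 / (2 * real n - 1))"
    using a_neq_q fst_rep_glue_class by (metis fst_conv)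
qed (use Hausdorff_succ_space succ_a_in succ_q_in in auto)

text \<open>A continuum \<open>K\<close> from the beginning of the zigzag to the end of level \<open>m\<close> or later is carried by
  \<open>collapse m\<close> to one that contains both ends of level \<open>m\<close>, hence all of \<open>[a, q\<^sup>j]\<close>, where
  \<open>j = (m + 1) div 2\<close>. Away from the ends only level \<open>m\<close> itself maps onto a point \<open>x\<close>, so \<open>K\<close> passes
  through \<open>(x, 1/m)\<close>. The index \<open>n\<close> is the least one for which the new \<open>q\<^sup>n\<close> does not precede the
  end of level \<open>m\<close>: it is \<open>j\<close> for odd \<open>m\<close> and \<open>j + 1\<close> for even \<open>m\<close>.\<close>

lemma cls_in_succ_cont_interval:
  assumes m: "1 \<le> m" and x: "x \<in> cont_interval X a (q ((m + 1) div 2))"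
    and ne: "x \<noteq> a" "x \<noteq> q ((m + 1) div 2)"
  defines "n \<equiv> (m + 2) div 2"
  shows "cls (x, 1 / real m) \<in> cont_interval succ_space (cls (a, 1)) (cls (q n, 1 / (2 * real n - 1)))"
    and "cls (x, 1 / real m) \<noteq> cls (a, 1)"
    and "cls (x, 1 / real m) \<noteq> cls (q n, 1 / (2 * real n - 1))"
proof -
  let ?r = "\<lambda>c. collapse m (rep c)"
  have n: "1 \<le> n"
    by (simp add: n_def)
  then have n': "2 * real n - 1 = real (2 * n - 1)"
    by (simp add: of_nat_diff)
  have nodes: "{node (m - 1), node m} = {a, q ((m + 1) div 2)}"
  proof (cases "even m")
    case True
    then have "odd (m - 1)" "(m + 1) div 2 = m div 2"
      using m by auto
    then show ?thesis
      using True m by (auto simp: node_def)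
  next
    case False
    then show ?thesis
      using m by (auto simp: node_def)
  qed
  have r: "continuous_map succ_space X ?r"
    using m by (intro continuous_map_succ_space continuous_map_collapse collapse_rep_cls)
  have rx: "?r (cls (x, 1 / real m)) = x"
    using m by (simp add: collapse_rep_cls)
  have ra: "?r (cls (a, 1)) = node (m - 1)"
    using m collapse_level[of m 1 a] by (auto simp: collapse_rep_cls node_def)
  have "m < 2 * n - 1 \<and> node m = a" if "even m"
    using that by (elim evenE) (simp add: n_def node_def)
  moreover have "m = 2 * n - 1 \<and> node m = q n" if "odd m"
    using that by (elim oddE) (simp add: n_def node_def)
  ultimately have rq: "?r (cls (q n, 1 / (2 * real n - 1))) = node m"
    unfolding n' using m n collapse_level[of m "2 * n - 1" "q n"]
    by (cases "even m") (auto simp: collapse_rep_cls simp del: of_nat_diff)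
  have xne: "x \<noteq> node (m - 1)" "x \<noteq> node m"
    using nodes ne by (metis insertI1 insertI2 insertE singletonD)+
  show "cls (x, 1 / real m) \<noteq> cls (a, 1)"
    using rx ra xne by metis
  show "cls (x, 1 / real m) \<noteq> cls (q n, 1 / (2 * real n - 1))"
    using rx rq xne by metis
  show "cls (x, 1 / real m) \<in> cont_interval succ_space (cls (a, 1)) (cls (q n, 1 / (2 * real n - 1)))"
    unfolding cont_interval_def
  proof (intro CollectI conjI allI impI; (elim conjE)?)
    show "cls (x, 1 / real m) \<in> topspace succ_space"
      using m x by (rule succ_cls_in)
    fix K
    assume K: "subcontinuum_of succ_space K" "cls (a, 1) \<in> K" "cls (q n, 1 / (2 * real n - 1)) \<in> K"
    then have "node (m - 1) \<in> ?r ` K" "node m \<in> ?r ` K"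
      using imageI[OF K(2), of ?r] imageI[OF K(3), of ?r] unfolding ra rq by simp_all
    then have "{node (m - 1), node m} \<subseteq> ?r ` K"
      by simp
    then have "a \<in> ?r ` K" "q ((m + 1) div 2) \<in> ?r ` K"
      unfolding nodes by simp_all
    then have "x \<in> ?r ` K"
      using a_neq_q[of "(m + 1) div 2"] m
      by (intro cont_interval_continuous_image[OF K(1) r Hausdorff _ _ _ x]) simp_all
    then obtain c where c: "c \<in> K" "x = ?r c"
      by blast
    then have "c \<in> topspace succ_space"
      using K(1) by (auto simp: subcontinuum_of_def)
    then obtain y t where yt: "c = cls (y, t)"
      unfolding topspace_succ_space by auto
    then have "x = collapse m (y, t)"
      using c m by (simp add: collapse_rep_cls)
    then have "y = x" "t = 1 / real m"
      using xne by (auto simp: collapse_def split: if_splits)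
    with yt c show "cls (x, 1 / real m) \<in> K"
      by simp
  qed
qed

lemma cls_levels_1_2_neq:
  assumes "x \<noteq> q 1"
  shows "cls (x, 1) \<noteq> cls (x, 1 / 2)"
proof
  assume "cls (x, 1) = cls (x, 1 / 2)"
  then have "collapse 1 (x, 1) = collapse 1 (x, 1 / 2)"
    using collapse_rep_cls[of 1 "(x, 1)"] collapse_rep_cls[of 1 "(x, 1 / 2)"] by simp
  then show False
    using assms by (simp add: collapse_def node_def)
qed

end

section \<open>Limit stages\<close>

lemma threads_subset: "threads I S \<subseteq> topspace (product_topology (\<lambda>\<beta>. stage_space (S \<beta>)) I)"
  by (auto simp: threads_def)

lemma topspace_limit_stage: "topspace (stage_space (limit_stage I S)) = Thread ` threads I S"
  using threads_subset[of I S] unfolding limit_stage_def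
  by (simp add: topspace_quotient_top topspace_subtopology_subset del: topspace_subtopology topspace_product_topology)

lemma continuous_map_limit_coord:
  assumes "i \<in> I"
  shows "continuous_map (stage_space (limit_stage I S)) (stage_space (S i)) (\<lambda>p. coord p i)"
proof -
  have "continuous_map (subtopology (product_topology (\<lambda>\<beta>. stage_space (S \<beta>)) I) (threads I S))
      (stage_space (S i)) ((\<lambda>p. coord p i) \<circ> Thread)"
    using continuous_map_product_coordinates[OF assms, of "\<lambda>\<beta>. stage_space (S \<beta>)"]
    by (simp add: comp_def continuous_map_from_subtopology)
  then show ?thesis
    unfolding limit_stage_def stage.simps
    by (rule continuous_compose_quotient_map[OF quotient_map_quotient_top])
qed

lemma threads_eqI:
  assumes "x \<in> threads I S" "y \<in> threads I S" "\<And>\<beta>. \<beta> \<in> I \<Longrightarrow> x \<beta> = y \<beta>"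
  shows "x = y"
proof -
  let ?P = "\<Pi>\<^sub>E \<beta>\<in>I. topspace (stage_space (S \<beta>))"
  have "x \<in> ?P" "y \<in> ?P"
    using assms by (auto simp: threads_def)
  then show ?thesis
    using assms(3) by (rule PiE_ext)
qed

lemma Hausdorff_limit_stage:
  assumes "\<And>\<beta>. \<beta> \<in> I \<Longrightarrow> Hausdorff_space (stage_space (S \<beta>))"
  shows "Hausdorff_space (stage_space (limit_stage I S))"
proof (rule Hausdorff_space_separating_maps)
  fix p p'
  assume "p \<in> topspace (stage_space (limit_stage I S))" "p' \<in> topspace (stage_space (limit_stage I S))"
    and ne: "p \<noteq> p'"
  then obtain x y where xy: "x \<in> threads I S" "y \<in> threads I S" "p = Thread x" "p' = Thread y"
    unfolding topspace_limit_stage by blast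
  then obtain \<beta> where \<beta>: "\<beta> \<in> I" "x \<beta> \<noteq> y \<beta>"
    using threads_eqI ne by metis
  then have "coord p \<beta> \<noteq> coord p' \<beta>"
    using xy by simp
  with assms[OF \<beta>(1)] continuous_map_limit_coord[OF \<beta>(1)]
  show "\<exists>(Y :: point topology) f. Hausdorff_space Y \<and>
      continuous_map (stage_space (limit_stage I S)) Y f \<and> f p \<noteq> f p'"
    by blast
qed

lemma restrict_in_threads:
  assumes "\<And>\<beta>. \<beta> \<in> I \<Longrightarrow> s \<beta> \<in> topspace (stage_space (S \<beta>))"
    and "\<And>\<beta> \<gamma>. \<lbrakk>\<beta> \<in> I; \<gamma> \<in> I; \<gamma> \<le> \<beta>\<rbrakk> \<Longrightarrow> bonding (S \<beta>) \<gamma> (s \<beta>) = s \<gamma>"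
  shows "restrict s I \<in> threads I S"
  using assms by (auto simp: threads_def)

text \<open>Each projection of a continuum \<open>K\<close> through \<open>u\<close> and \<open>w\<close> with index in \<open>J\<close> contains \<open>s \<beta>\<close>, so the closed sets of
  points of \<open>K\<close> with coordinate \<open>s \<beta>\<close> are nonempty. They decrease with \<open>\<beta>\<close>, hence have a common point
  by compactness of \<open>K\<close>, and it is \<open>s\<close>. The hypothesis is restricted to a cofinal \<open>J\<close> because the index
  \<open>n\<close> of the interval \<open>[a, q\<^sup>n]\<close> that contains a lift may grow below a limit stage.\<close>

lemma Thread_in_limit_cont_interval:
  fixes S :: "omega1 \<Rightarrow> stage"
  assumes H: "\<And>\<beta>. \<beta> \<in> I \<Longrightarrow> Hausdorff_space (stage_space (S \<beta>))"
    and J: "J \<subseteq> I" "\<And>\<gamma>. \<gamma> \<in> I \<Longrightarrow> \<exists>\<beta>\<in>J. \<gamma> \<le> \<beta>" "J \<noteq> {}"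
    and s: "s \<in> threads I S"
    and int: "\<And>\<beta>. \<beta> \<in> J \<Longrightarrow> s \<beta> \<in> cont_interval (stage_space (S \<beta>)) (u \<beta>) (w \<beta>)"
    and ne: "\<And>\<beta>. \<beta> \<in> J \<Longrightarrow> u \<beta> \<noteq> w \<beta>"
  shows "Thread s \<in> cont_interval (stage_space (limit_stage I S)) (Thread u) (Thread w)"
  unfolding cont_interval_def
proof (intro CollectI conjI allI impI; (elim conjE)?)
  let ?L = "stage_space (limit_stage I S)"
  show "Thread s \<in> topspace ?L"
    using s by (simp add: topspace_limit_stage)
  fix K
  assume K: "subcontinuum_of ?L K" and uK: "Thread u \<in> K" and wK: "Thread w \<in> K"
  define C where "C \<beta> = {p \<in> topspace (subtopology ?L K). coord p \<beta> = s \<beta>}" for \<beta>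
  have KL: "K \<subseteq> topspace ?L"
    using K by (simp add: subcontinuum_of_def)
  have thr: "\<exists>x\<in>threads I S. p = Thread x" if "p \<in> K" for p
    using that KL by (auto simp: topspace_limit_stage)
  have closed: "closedin (subtopology ?L K) (C \<beta>)" if "\<beta> \<in> J" for \<beta>
  proof -
    have "s \<beta> \<in> topspace (stage_space (S \<beta>))"
      using int[OF that] by (simp add: cont_interval_def)
    then have "closedin (stage_space (S \<beta>)) {s \<beta>}"
      using H that J(1) by (intro closedin_Hausdorff_singleton) auto
    moreover have "continuous_map (subtopology ?L K) (stage_space (S \<beta>)) (\<lambda>p. coord p \<beta>)"
      using that J(1) by (intro continuous_map_from_subtopology continuous_map_limit_coord) auto
    ultimately show ?thesis
      using closedin_continuous_map_preimage[of "subtopology ?L K" _ "\<lambda>p. coord p \<beta>" "{s \<beta>}"]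
      by (simp add: C_def)
  qed
  have nonempty: "C \<beta> \<noteq> {}" if "\<beta> \<in> J" for \<beta>
  proof -
    have "s \<beta> \<in> (\<lambda>p. coord p \<beta>) ` K"
    proof (rule cont_interval_continuous_image[OF K _ _ _ _ ne[OF that] int[OF that]])
      show "continuous_map ?L (stage_space (S \<beta>)) (\<lambda>p. coord p \<beta>)"
        using that J(1) by (intro continuous_map_limit_coord) auto
      show "u \<beta> \<in> (\<lambda>p. coord p \<beta>) ` K" "w \<beta> \<in> (\<lambda>p. coord p \<beta>) ` K"
        using imageI[OF uK, of "\<lambda>p. coord p \<beta>"] imageI[OF wK, of "\<lambda>p. coord p \<beta>"] by simp_all
    qed (use H that J(1) in auto)
    then show ?thesis
      using KL by (auto simp: C_def)
  qed
  have below: "coord p \<gamma> = s \<gamma>" if "p \<in> C \<beta>" "\<gamma> \<le> \<beta>" "\<gamma> \<in> I" "\<beta> \<in> J" for p \<beta> \<gamma>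
  proof -
    have "p \<in> K"
      using that by (auto simp: C_def)
    then obtain x where "x \<in> threads I S" "p = Thread x"
      using thr by blast
    then have "coord p \<gamma> = bonding (S \<beta>) \<gamma> (coord p \<beta>)"
      using that J(1) by (auto simp: threads_def)
    also have "\<dots> = s \<gamma>"
      using s that J(1) by (auto simp: threads_def C_def)
    finally show ?thesis .
  qed
  have "compact_space (subtopology ?L K)"
    using K by (simp add: subcontinuum_of_def continuum_space_def)
  moreover have "\<Inter>F \<noteq> {}" if F: "finite F" "F \<subseteq> C ` J" for F
  proof (cases "F = {}")
    case False
    obtain B where B: "finite B" "B \<subseteq> J" "F = C ` B"
      using finite_subset_image[OF F] by blast
    with False have "Max B \<in> B"
      by (intro Max_in) auto
    with B have M: "Max B \<in> J" "\<And>\<gamma>. \<gamma> \<in> B \<Longrightarrow> \<gamma> \<le> Max B"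
      by auto
    then have "C (Max B) \<subseteq> C \<gamma>" if "\<gamma> \<in> B" for \<gamma>
      using below[of _ "Max B" \<gamma>] that B(2) J(1) by (auto simp: C_def)
    then have "C (Max B) \<subseteq> \<Inter>F"
      using B by blast
    then show ?thesis
      using nonempty M by blast
  qed simp
  ultimately have "\<Inter>(C ` J) \<noteq> {}"
    using closed unfolding compact_space_fip by blast
  then obtain p where p: "\<And>\<beta>. \<beta> \<in> J \<Longrightarrow> p \<in> C \<beta>"
    by blast
  then have "p \<in> K"
    using J(3) by (auto simp: C_def)
  then obtain x where x: "x \<in> threads I S" "p = Thread x"
    using thr by blast
  have "x = s"
  proof (rule threads_eqI[OF x(1) s])
    fix \<gamma>
    assume "\<gamma> \<in> I"
    then obtain \<beta> where "\<beta> \<in> J" "\<gamma> \<le> \<beta>"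
      using J(2) by blast
    then show "x \<gamma> = s \<gamma>"
      using below[OF p] \<open>\<gamma> \<in> I\<close> x(2) by fastforce
  qed
  with x \<open>p \<in> K\<close> show "Thread s \<in> K"
    by simp
qed

section \<open>Lifts through the tower\<close>

definition is_limit :: "omega1 \<Rightarrow> bool" where
  "is_limit \<alpha> \<longleftrightarrow> (\<exists>\<beta>. \<beta> < \<alpha>) \<and> (\<forall>\<beta>. \<not> is_succ \<beta> \<alpha>)"

lemma omega1_cases:
  obtains (zero) "\<forall>\<beta>. \<alpha> \<le> \<beta>" | (succ) \<beta> where "is_succ \<beta> \<alpha>" | (limit) "is_limit \<alpha>"
  unfolding is_limit_def by (meson not_le)

lemma is_limit_dense: "is_limit \<alpha> \<Longrightarrow> \<gamma> < \<alpha> \<Longrightarrow> \<exists>\<beta>. \<gamma> < \<beta> \<and> \<beta> < \<alpha>"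
  unfolding is_limit_def is_succ_def by blast

lemma ex_is_succ: "\<exists>\<alpha>. is_succ \<beta> \<alpha>"
proof -
  have "\<exists>\<alpha>. \<beta> < \<alpha>"
  proof (rule ccontr)
    assume "\<not> ?thesis"
    then have "UNIV = insert \<beta> {..<\<beta>}"
      by (auto simp: not_less le_less)
    then show False
      using uncountable_omega1 countable_lessThan_omega1[of \<beta>] by (metis countable_insert)
  qed
  then have "is_succ \<beta> (LEAST \<alpha>. \<beta> < \<alpha>)"
    unfolding is_succ_def using not_less_Least by (metis LeastI_ex)
  then show ?thesis ..
qed

lemma countable_bounded:
  fixes A :: "omega1 set"
  assumes "countable A"
  shows "\<exists>\<delta>. \<forall>\<alpha>\<in>A. \<alpha> \<le> \<delta>"
proof (rule ccontr)
  assume "\<not> ?thesis"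
  then have "UNIV = (\<Union>\<alpha>\<in>A. {..<\<alpha>})"
    by (auto simp: not_le)
  then show False
    using uncountable_omega1 countable_lessThan_omega1 assms by (metis countable_UN)
qed

lemma stage_at_zero: "\<forall>\<beta>. \<alpha> \<le> \<beta> \<Longrightarrow> stage_at q0 \<alpha> = zero_stage q0"
  by (simp add: stage_at.simps[of q0 \<alpha>])

lemma stage_at_succ:
  assumes "is_succ \<beta> \<alpha>"
  shows "stage_at q0 \<alpha> = succ_stage \<beta> (stage_at q0 \<beta>)"
proof -
  have "(\<forall>\<beta>. \<alpha> \<le> \<beta>) = False" "(\<exists>\<beta>. is_succ \<beta> \<alpha>) = True"
    using assms by (auto simp: is_succ_def not_le)
  then show ?thesis
    by (subst stage_at.simps) (simp only: the_is_succ[OF assms] if_True if_False)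
qed

lemma stage_at_limit:
  assumes "is_limit \<alpha>"
  shows "stage_at q0 \<alpha> = limit_stage {..<\<alpha>} (stage_at q0)"
proof -
  have "(\<forall>\<beta>. \<alpha> \<le> \<beta>) = False" "(\<exists>\<beta>. is_succ \<beta> \<alpha>) = False"
    using assms by (auto simp: is_limit_def not_le)
  then show ?thesis
    by (subst stage_at.simps) (simp only: if_False)
qed

abbreviation space_at :: "(nat \<Rightarrow> real \<times> real) \<Rightarrow> omega1 \<Rightarrow> point topology" where
  "space_at q0 \<alpha> \<equiv> stage_space (stage_at q0 \<alpha>)"

abbreviation a_at :: "(nat \<Rightarrow> real \<times> real) \<Rightarrow> omega1 \<Rightarrow> point" where
  "a_at q0 \<alpha> \<equiv> stage_a (stage_at q0 \<alpha>)"

abbreviation q_at :: "(nat \<Rightarrow> real \<times> real) \<Rightarrow> omega1 \<Rightarrow> nat \<Rightarrow> point" where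
  "q_at q0 \<alpha> \<equiv> stage_q (stage_at q0 \<alpha>)"

text \<open>A family of points, one at each stage, that is the lift to level \<open>lev \<beta>\<close> at stage \<open>\<beta> + 1\<close> and the
  thread of its predecessors at limit stages. The points \<open>a\<^sub>\<alpha>\<close> and \<open>q\<^sub>\<alpha>\<^sup>n\<close> are families of this kind.
  Coherence under the bonding maps is a consequence of these equations alone (\<open>bonding_lift\<close>), which
  makes it available for the induction that puts the points into the spaces.\<close>

definition is_lift :: "(nat \<Rightarrow> real \<times> real) \<Rightarrow> (omega1 \<Rightarrow> real) \<Rightarrow> (omega1 \<Rightarrow> point) \<Rightarrow> bool" where
  "is_lift q0 lev s \<longleftrightarrow>
     (\<forall>\<alpha> \<beta>. is_succ \<beta> \<alpha> \<longrightarrow> s \<alpha> = glue_class (a_at q0 \<beta>) (q_at q0 \<beta>) (s \<beta>, lev \<beta>)) \<and>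
     (\<forall>\<alpha>. is_limit \<alpha> \<longrightarrow> s \<alpha> = Thread (restrict s {..<\<alpha>}))"

lemma is_lift_a: "is_lift q0 (\<lambda>_. 1) (a_at q0)"
  by (auto simp: is_lift_def stage_at_succ stage_at_limit succ_stage_def limit_stage_def Let_def)

lemma is_lift_q: "is_lift q0 (\<lambda>_. 1 / (2 * real n - 1)) (\<lambda>\<alpha>. q_at q0 \<alpha> n)"
  by (auto simp: is_lift_def stage_at_succ stage_at_limit succ_stage_def limit_stage_def Let_def)

lemma space_at_succ:
  assumes "is_succ \<beta> \<alpha>"
  shows "space_at q0 \<alpha> = quotient_top
      (subtopology (prod_topology (space_at q0 \<beta>) (top_of_set {0..1}))
        (zigzag (space_at q0 \<beta>) (a_at q0 \<beta>) (q_at q0 \<beta>)))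
      (glue_class (a_at q0 \<beta>) (q_at q0 \<beta>))"
    "a_at q0 \<alpha> = glue_class (a_at q0 \<beta>) (q_at q0 \<beta>) (a_at q0 \<beta>, 1)"
    "q_at q0 \<alpha> = (\<lambda>n. glue_class (a_at q0 \<beta>) (q_at q0 \<beta>) (q_at q0 \<beta> n, 1 / (2 * real n - 1)))"
  by (simp_all add: stage_at_succ[OF assms] succ_stage_def Let_def)

lemma bonding_lift:
  assumes lift: "is_lift q0 lev s" and "\<gamma> \<le> \<alpha>"
  shows "bonding (stage_at q0 \<alpha>) \<gamma> (s \<alpha>) = s \<gamma>"
  using assms(2)
proof (induction \<alpha> arbitrary: \<gamma> rule: less_induct)
  case (less \<alpha>)
  show ?case
  proof (cases \<alpha> rule: omega1_cases)
    case zero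
    then have "\<gamma> = \<alpha>"
      using less.prems by (simp add: order_antisym)
    then show ?thesis
      by (simp add: stage_at_zero[OF zero] zero_stage_def)
  next
    case (succ \<beta>)
    show ?thesis
    proof (cases "\<gamma> \<le> \<beta>")
      case True
      have "s \<alpha> = glue_class (a_at q0 \<beta>) (q_at q0 \<beta>) (s \<beta>, lev \<beta>)"
        using lift succ by (simp add: is_lift_def)
      then show ?thesis
        using less.IH[of \<beta> \<gamma>] True succ
        by (simp add: stage_at_succ[OF succ] succ_stage_def Let_def fst_rep_glue_class is_succ_def)
    next
      case False
      then have "\<gamma> = \<alpha>"
        using succ less.prems by (meson is_succ_def le_less not_le)
      then show ?thesis
        using False by (simp add: stage_at_succ[OF succ] succ_stage_def Let_def)
    qed
  next
    case limit
    then have "s \<alpha> = Thread (restrict s {..<\<alpha>})"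
      using lift by (simp add: is_lift_def)
    then show ?thesis
      using less.prems by (auto simp: stage_at_limit[OF limit] limit_stage_def)
  qed
qed

lemma lift_in_limit:
  assumes "is_lift q0 lev s" "is_limit \<alpha>" "\<And>\<beta>. \<beta> < \<alpha> \<Longrightarrow> s \<beta> \<in> topspace (space_at q0 \<beta>)"
  shows "restrict s {..<\<alpha>} \<in> threads {..<\<alpha>} (stage_at q0)" "s \<alpha> \<in> topspace (space_at q0 \<alpha>)"
proof -
  show "restrict s {..<\<alpha>} \<in> threads {..<\<alpha>} (stage_at q0)"
    using assms bonding_lift by (intro restrict_in_threads) auto
  then show "s \<alpha> \<in> topspace (space_at q0 \<alpha>)"
    using assms(1,2) unfolding stage_at_limit[OF assms(2)] topspace_limit_stage is_lift_def by blast
qed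

lemma continuous_map_zero_stage:
  "continuous_map (stage_space (zero_stage q0)) (top_of_set sin_continuum) (the_inv Plane)"
  unfolding zero_stage_def stage.simps
  by (rule continuous_compose_quotient_map[OF quotient_map_quotient_top])
    (simp add: comp_def the_inv_f_f inj_def)

lemma topspace_zero_stage: "topspace (stage_space (zero_stage q0)) = Plane ` sin_continuum"
  by (simp add: zero_stage_def topspace_quotient_top)

lemma marked_space_zero_stage:
  assumes q0: "\<forall>n\<ge>1. q0 n \<in> sin_graph"
  shows "marked_space (stage_space (zero_stage q0)) (stage_a (zero_stage q0)) (stage_q (zero_stage q0))"
proof
  show "Hausdorff_space (stage_space (zero_stage q0))"
  proof (rule Hausdorff_space_separating_maps)
    fix x y
    assume "x \<in> topspace (stage_space (zero_stage q0))" "y \<in> topspace (stage_space (zero_stage q0))"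
      and "x \<noteq> y"
    then have "the_inv Plane x \<noteq> the_inv Plane y"
      by (auto simp: topspace_zero_stage the_inv_f_f inj_def)
    then show "\<exists>(Y :: (real \<times> real) topology) f. Hausdorff_space Y \<and>
        continuous_map (stage_space (zero_stage q0)) Y f \<and> f x \<noteq> f y"
      using continuous_map_zero_stage Hausdorff_space_subtopology[OF Hausdorff_space_euclidean] by blast
  qed
  have "sin (1 / (-2 / pi)) = -1"
    using sin_minus[of "pi / 2"] by simp
  then have "(-2 / pi, -1) \<in> sin_continuum"
    unfolding sin_continuum_def by (intro UnI1 CollectI exI[of _ "-2 / pi"]) auto
  then show "stage_a (zero_stage q0) \<in> topspace (stage_space (zero_stage q0))"
    by (simp add: topspace_zero_stage) (simp add: zero_stage_def)
next
  fix n :: nat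
  assume "1 \<le> n"
  then have "q0 n \<in> sin_graph"
    using q0 by blast
  then have "q0 n \<in> sin_continuum" "q0 n \<noteq> (-2 / pi, -1)"
    by (auto simp: sin_graph_def sin_continuum_def)
  then show "stage_q (zero_stage q0) n \<in> topspace (stage_space (zero_stage q0))"
    and "stage_a (zero_stage q0) \<noteq> stage_q (zero_stage q0) n"
    by (auto simp: topspace_zero_stage) (auto simp: zero_stage_def)
qed

lemma marked_space_stage:
  assumes q0: "\<forall>n\<ge>1. q0 n \<in> sin_graph"
  shows "marked_space (space_at q0 \<alpha>) (a_at q0 \<alpha>) (q_at q0 \<alpha>)"
proof (induction \<alpha> rule: less_induct)
  case (less \<alpha>)
  show ?case
  proof (cases \<alpha> rule: omega1_cases)
    case zero
    then show ?thesis
      using marked_space_zero_stage[OF q0] by (simp add: stage_at_zero)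
  next
    case (succ \<beta>)
    then have "\<beta> < \<alpha>"
      by (simp add: is_succ_def)
    then show ?thesis
      unfolding space_at_succ[OF succ] by (intro marked_space.marked_space_succ less.IH)
  next
    case limit
    then obtain \<beta> where \<beta>: "\<beta> < \<alpha>"
      by (auto simp: is_limit_def)
    show ?thesis
    proof
      show "Hausdorff_space (space_at q0 \<alpha>)"
        unfolding stage_at_limit[OF limit]
        using less.IH by (intro Hausdorff_limit_stage) (auto simp: marked_space_def)
      show "a_at q0 \<alpha> \<in> topspace (space_at q0 \<alpha>)"
        using less.IH by (intro lift_in_limit[OF is_lift_a limit]) (auto simp: marked_space_def)
    next
      fix n :: nat
      assume n: "1 \<le> n"
      show "q_at q0 \<alpha> n \<in> topspace (space_at q0 \<alpha>)"
        using less.IH n by (intro lift_in_limit[OF is_lift_q limit]) (auto simp: marked_space_def)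
      have "bonding (stage_at q0 \<alpha>) \<beta> (a_at q0 \<alpha>) \<noteq> bonding (stage_at q0 \<alpha>) \<beta> (q_at q0 \<alpha> n)"
        using less.IH[OF \<beta>] n \<beta> bonding_lift[OF is_lift_a, of \<beta> \<alpha> q0] bonding_lift[OF is_lift_q, of \<beta> \<alpha> q0 n]
        by (simp add: marked_space_def)
      then show "a_at q0 \<alpha> \<noteq> q_at q0 \<alpha> n"
        by metis
    qed
  qed
qed

text \<open>A connected set through \<open>a\<^sub>0\<close> and \<open>q\<^sub>0\<^sup>1\<close> has an interval as its projection to the first coordinate, and
  over a negative coordinate the \<open>sin (1/x)\<close> continuum has only one point.\<close>

lemma ex_interior_point_zero_stage:
  assumes q0: "\<forall>n\<ge>1. q0 n \<in> sin_graph"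
  defines "S \<equiv> zero_stage q0"
  shows "\<exists>z. z \<in> cont_interval (stage_space S) (stage_a S) (stage_q S 1) \<and> z \<noteq> stage_a S \<and> z \<noteq> stage_q S 1"
proof -
  let ?h = "\<lambda>c. fst (the_inv Plane c)"
  have h_Plane: "?h (Plane v) = fst v" for v
    by (simp add: the_inv_f_f inj_def)
  have "- 2 / pi < fst (q0 1)" "fst (q0 1) < 0"
    using spec[OF q0, of 1] by (auto simp: sin_graph_def)
  then obtain x where x: "- 2 / pi < x" "x < fst (q0 1)" "x < 0"
    by (meson dense less_trans)
  have h: "continuous_map (stage_space S) euclideanreal ?h"
    using continuous_map_compose[OF continuous_map_into_fulltopology[OF continuous_map_zero_stage], of euclideanreal fst]
    by (simp add: S_def comp_def continuous_map_iff_continuous2 continuous_on_fst)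
  have "Plane (x, sin (1 / x)) \<in> cont_interval (stage_space S) (stage_a S) (stage_q S 1)"
    unfolding cont_interval_def
  proof (intro CollectI conjI allI impI; (elim conjE)?)
    show "Plane (x, sin (1 / x)) \<in> topspace (stage_space S)"
      using x by (auto simp: S_def topspace_zero_stage sin_continuum_def)
    fix K
    assume K: "subcontinuum_of (stage_space S) K" "stage_a S \<in> K" "stage_q S 1 \<in> K"
    have KS: "K \<subseteq> Plane ` sin_continuum"
      using K(1) by (auto simp: subcontinuum_of_def S_def topspace_zero_stage)
    have "connectedin (stage_space S) K"
      using K(1) by (simp add: subcontinuum_of_def continuum_space_def connectedin_def)
    then have "connected (?h ` K)"
      using connectedin_continuous_map_image[OF h] by simp
    moreover have "- 2 / pi \<in> ?h ` K" "fst (q0 1) \<in> ?h ` K"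
      using imageI[OF K(2), of ?h] imageI[OF K(3), of ?h] by (simp_all add: S_def zero_stage_def h_Plane)
    ultimately have "x \<in> ?h ` K"
      using x by (intro connectedD_interval[of "?h ` K" "- 2 / pi" "fst (q0 1)" x]) auto
    then obtain c where c: "c \<in> K" "x = ?h c"
      by blast
    then obtain v where v: "v \<in> sin_continuum" "c = Plane v"
      using KS by blast
    then have "fst v = x"
      using c by (simp add: h_Plane)
    then have "v = (x, sin (1 / x))"
      using v(1) x by (auto simp: sin_continuum_def)
    then show "Plane (x, sin (1 / x)) \<in> K"
      using c v by simp
  qed
  moreover have "Plane (x, sin (1 / x)) \<noteq> stage_a S"
    using x by (simp add: S_def zero_stage_def)
  moreover have "Plane (x, sin (1 / x)) \<noteq> stage_q S 1"
    using x by (cases "q0 1") (auto simp: S_def zero_stage_def)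
  ultimately show ?thesis
    by blast
qed

function lift_from :: "(nat \<Rightarrow> real \<times> real) \<Rightarrow> point \<Rightarrow> (omega1 \<Rightarrow> real) \<Rightarrow> omega1 \<Rightarrow> point" where
  "lift_from q0 p lev \<alpha> =
    (if \<forall>\<beta>. \<alpha> \<le> \<beta> then p
     else if \<exists>\<beta>. is_succ \<beta> \<alpha>
       then glue_class (a_at q0 (THE \<beta>. is_succ \<beta> \<alpha>)) (q_at q0 (THE \<beta>. is_succ \<beta> \<alpha>))
         (lift_from q0 p lev (THE \<beta>. is_succ \<beta> \<alpha>), lev (THE \<beta>. is_succ \<beta> \<alpha>))
     else Thread (\<lambda>\<beta>. if \<beta> < \<alpha> then lift_from q0 p lev \<beta> else undefined))"
  by pat_completeness auto
termination
proof (relation "inv_image {(\<beta>, \<alpha> :: omega1). \<beta> < \<alpha>} (\<lambda>(_, _, _, \<alpha>). \<alpha>)")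
  show "wf (inv_image {(\<beta>, \<alpha> :: omega1). \<beta> < \<alpha>}
      (\<lambda>(_ :: nat \<Rightarrow> real \<times> real, _ :: point, _ :: omega1 \<Rightarrow> real, \<alpha>). \<alpha>))"
    by (intro wf_inv_image wellorder_class.wf)
qed (auto simp: the_is_succ is_succ_def[THEN iffD1])

declare lift_from.simps [simp del]

lemma lift_from_zero: "\<forall>\<beta>. \<alpha> \<le> \<beta> \<Longrightarrow> lift_from q0 p lev \<alpha> = p"
  by (subst lift_from.simps) simp

lemma lift_from_succ:
  assumes "is_succ \<beta> \<alpha>"
  shows "lift_from q0 p lev \<alpha> = glue_class (a_at q0 \<beta>) (q_at q0 \<beta>) (lift_from q0 p lev \<beta>, lev \<beta>)"
proof -
  have "(\<forall>\<beta>. \<alpha> \<le> \<beta>) = False" "(\<exists>\<beta>. is_succ \<beta> \<alpha>) = True"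
    using assms by (auto simp: is_succ_def not_le)
  then show ?thesis
    by (subst lift_from.simps) (simp only: the_is_succ[OF assms] if_True if_False)
qed

lemma lift_from_limit:
  assumes "is_limit \<alpha>"
  shows "lift_from q0 p lev \<alpha> = Thread (restrict (lift_from q0 p lev) {..<\<alpha>})"
proof -
  have "(\<forall>\<beta>. \<alpha> \<le> \<beta>) = False" "(\<exists>\<beta>. is_succ \<beta> \<alpha>) = False"
    using assms by (auto simp: is_limit_def not_le)
  then have "lift_from q0 p lev \<alpha> = Thread (\<lambda>\<beta>. if \<beta> < \<alpha> then lift_from q0 p lev \<beta> else undefined)"
    by (subst lift_from.simps) (simp only: if_False)
  then show ?thesis
    by (simp add: restrict_def)
qed

lemma is_lift_lift_from: "is_lift q0 lev (lift_from q0 p lev)"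
  by (simp add: is_lift_def lift_from_succ lift_from_limit)

lemma lift_from_cong:
  assumes "\<And>\<beta>. \<beta> < \<alpha> \<Longrightarrow> lev \<beta> = lev' \<beta>"
  shows "lift_from q0 p lev \<alpha> = lift_from q0 p lev' \<alpha>"
  using assms
proof (induction \<alpha> rule: less_induct)
  case (less \<alpha>)
  then have IH: "lift_from q0 p lev \<beta> = lift_from q0 p lev' \<beta>" if "\<beta> < \<alpha>" for \<beta>
    using that by simp
  show ?case
  proof (cases \<alpha> rule: omega1_cases)
    case zero
    then show ?thesis
      by (simp add: lift_from_zero)
  next
    case (succ \<beta>)
    then have "\<beta> < \<alpha>"
      by (simp add: is_succ_def)
    then show ?thesis
      using IH less.prems by (simp add: lift_from_succ[OF succ])
  next
    case limit
    have "restrict (lift_from q0 p lev) {..<\<alpha>} = restrict (lift_from q0 p lev') {..<\<alpha>}"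
      using IH by (intro restrict_ext) auto
    then show ?thesis
      by (simp add: lift_from_limit[OF limit])
  qed
qed

definition interior_at :: "(nat \<Rightarrow> real \<times> real) \<Rightarrow> omega1 \<Rightarrow> nat \<Rightarrow> point \<Rightarrow> bool" where
  "interior_at q0 \<alpha> n x \<longleftrightarrow>
     x \<in> cont_interval (space_at q0 \<alpha>) (a_at q0 \<alpha>) (q_at q0 \<alpha> n) \<and> x \<noteq> a_at q0 \<alpha> \<and> x \<noteq> q_at q0 \<alpha> n"

text \<open>The interval \<open>[a, q\<^sup>j]\<close> is the one whose copy is level \<open>m \<alpha>\<close>. Its index must be the one that
  the previous step leads to, and below a limit stage it must be eventually constant, because only
  intervals with a fixed index are compatible with the projections.\<close>

lemma lift_interior_at:
  fixes m :: "omega1 \<Rightarrow> nat"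
  defines "j \<equiv> \<lambda>\<alpha>. (m \<alpha> + 1) div 2"
  assumes q0: "\<forall>n\<ge>1. q0 n \<in> sin_graph"
    and lift: "is_lift q0 (\<lambda>\<alpha>. 1 / real (m \<alpha>)) s"
    and m: "\<And>\<alpha>. 1 \<le> m \<alpha>"
    and zero: "\<And>\<alpha>. \<forall>\<beta>. \<alpha> \<le> \<beta> \<Longrightarrow> interior_at q0 \<alpha> (j \<alpha>) (s \<alpha>)"
    and j_succ: "\<And>\<alpha> \<beta>. is_succ \<beta> \<alpha> \<Longrightarrow> j \<alpha> = (m \<beta> + 2) div 2"
    and j_limit: "\<And>\<alpha>. is_limit \<alpha> \<Longrightarrow> \<exists>\<mu><\<alpha>. \<forall>\<beta>. \<mu> \<le> \<beta> \<and> \<beta> < \<alpha> \<longrightarrow> j \<beta> = j \<alpha>"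
  shows "interior_at q0 \<alpha> (j \<alpha>) (s \<alpha>)"
proof (induction \<alpha> rule: less_induct)
  case (less \<alpha>)
  show ?case
  proof (cases \<alpha> rule: omega1_cases)
    case zero
    then show ?thesis
      by (rule assms(5))
  next
    case (succ \<beta>)
    then have "\<beta> < \<alpha>"
      by (simp add: is_succ_def)
    then have IH: "interior_at q0 \<beta> ((m \<beta> + 1) div 2) (s \<beta>)"
      using less unfolding j_def by blast
    interpret marked_space "space_at q0 \<beta>" "a_at q0 \<beta>" "q_at q0 \<beta>"
      by (rule marked_space_stage[OF q0])
    have s: "s \<alpha> = cls (s \<beta>, 1 / real (m \<beta>))"
      using lift succ by (simp add: is_lift_def)
    show ?thesis
      using IH cls_in_succ_cont_interval[OF m, of "s \<beta>" \<beta>]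
      unfolding interior_at_def s j_succ[OF succ] space_at_succ[OF succ] by blast
  next
    case limit
    then obtain \<mu> where \<mu>: "\<mu> < \<alpha>" "\<And>\<beta>. \<mu> \<le> \<beta> \<Longrightarrow> \<beta> < \<alpha> \<Longrightarrow> j \<beta> = j \<alpha>"
      using j_limit by blast
    have IH: "interior_at q0 \<beta> (j \<alpha>) (s \<beta>)" if "\<mu> \<le> \<beta>" "\<beta> < \<alpha>" for \<beta>
      using less.IH[OF that(2)] \<mu>(2)[OF that] by simp
    have eqs: "s \<alpha> = Thread (restrict s {..<\<alpha>})"
      "a_at q0 \<alpha> = Thread (restrict (a_at q0) {..<\<alpha>})"
      "q_at q0 \<alpha> (j \<alpha>) = Thread (restrict (\<lambda>\<beta>. q_at q0 \<beta> (j \<alpha>)) {..<\<alpha>})"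
      using lift is_lift_a[of q0] is_lift_q[of q0 "j \<alpha>"] limit unfolding is_lift_def by blast+
    have j1: "1 \<le> j \<alpha>"
      using m[of \<alpha>] by (simp add: j_def)
    have "Thread (restrict s {..<\<alpha>}) \<in> cont_interval (stage_space (limit_stage {..<\<alpha>} (stage_at q0)))
        (Thread (restrict (a_at q0) {..<\<alpha>})) (Thread (restrict (\<lambda>\<beta>. q_at q0 \<beta> (j \<alpha>)) {..<\<alpha>}))"
    proof (rule Thread_in_limit_cont_interval[where J = "{\<mu>..<\<alpha>}"])
      show "Hausdorff_space (space_at q0 \<beta>)" for \<beta>
        using marked_space_stage[OF q0] by (simp add: marked_space_def)
      show "\<exists>\<beta>\<in>{\<mu>..<\<alpha>}. \<gamma> \<le> \<beta>" if "\<gamma> \<in> {..<\<alpha>}" for \<gamma>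
        using that \<mu>(1) by (intro bexI[of _ "max \<gamma> \<mu>"]) auto
      show "restrict s {..<\<alpha>} \<in> threads {..<\<alpha>} (stage_at q0)"
        using less.IH by (intro lift_in_limit[OF lift limit]) (simp add: interior_at_def cont_interval_def)
      show "restrict s {..<\<alpha>} \<beta> \<in> cont_interval (space_at q0 \<beta>)
          (restrict (a_at q0) {..<\<alpha>} \<beta>) (restrict (\<lambda>\<beta>. q_at q0 \<beta> (j \<alpha>)) {..<\<alpha>} \<beta>)"
        if "\<beta> \<in> {\<mu>..<\<alpha>}" for \<beta>
        using IH[of \<beta>] that by (simp add: interior_at_def)
      show "restrict (a_at q0) {..<\<alpha>} \<beta> \<noteq> restrict (\<lambda>\<beta>. q_at q0 \<beta> (j \<alpha>)) {..<\<alpha>} \<beta>"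
        if "\<beta> \<in> {\<mu>..<\<alpha>}" for \<beta>
        using marked_space.a_neq_q[OF marked_space_stage[OF q0] j1] that by simp
    qed (use \<mu>(1) in auto)
    then have "s \<alpha> \<in> cont_interval (space_at q0 \<alpha>) (a_at q0 \<alpha>) (q_at q0 \<alpha> (j \<alpha>))"
      by (simp only: stage_at_limit[OF limit, symmetric] eqs[symmetric])
    moreover have "s \<alpha> \<noteq> a_at q0 \<alpha>" "s \<alpha> \<noteq> q_at q0 \<alpha> (j \<alpha>)"
      using IH[of \<mu>] \<mu>(1) bonding_lift[OF lift less_imp_le[OF \<mu>(1)]]
        bonding_lift[OF is_lift_a less_imp_le[OF \<mu>(1)], of q0]
        bonding_lift[OF is_lift_q less_imp_le[OF \<mu>(1)], of q0 "j \<alpha>"]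
      by (auto simp: interior_at_def)
    ultimately show ?thesis
      by (simp add: interior_at_def)
  qed
qed

section \<open>The nontrivial composant\<close>

lemma lift_in_threads:
  assumes "is_lift q0 lev s" "\<And>\<alpha>. s \<alpha> \<in> topspace (space_at q0 \<alpha>)"
  shows "s \<in> threads UNIV (stage_at q0)"
proof -
  have "restrict s UNIV \<in> threads UNIV (stage_at q0)"
    using assms bonding_lift by (intro restrict_in_threads) auto
  then show ?thesis
    by (simp add: restrict_def)
qed

text \<open>A point of the embedded \<open>X(\<beta>)\<close> lies in \<open>X(\<beta>) \<times> {0}\<close> at stage \<open>\<beta> + 1\<close>, and gluing never
  touches level \<open>0\<close>.\<close>

lemma lift_notin_trivial_composant:
  assumes lift: "is_lift q0 lev s" and lev: "\<And>\<alpha>. lev \<alpha> \<noteq> 0"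
  shows "Thread s \<notin> trivial_composant q0"
proof
  assume "Thread s \<in> trivial_composant q0"
  then obtain \<beta> p where s: "Thread s = embed (final_stage q0) \<beta> p"
    by (auto simp: trivial_composant_def)
  obtain \<alpha> where \<alpha>: "is_succ \<beta> \<alpha>"
    using ex_is_succ by blast
  have "s \<alpha> = embed (stage_at q0 \<alpha>) \<beta> p"
    using s \<alpha> by (auto simp: final_stage_def limit_stage_def is_succ_def)
  also have "\<dots> = glue_class (a_at q0 \<beta>) (q_at q0 \<beta>) (embed (stage_at q0 \<beta>) \<beta> p, 0)"
    by (simp add: stage_at_succ[OF \<alpha>] succ_stage_def Let_def)
  finally have "snd (rep (s \<alpha>)) = 0"
    by (simp add: snd_rep_glue_class_eq_0_iff)
  moreover have "s \<alpha> = glue_class (a_at q0 \<beta>) (q_at q0 \<beta>) (s \<beta>, lev \<beta>)"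
    using lift \<alpha> by (simp add: is_lift_def)
  ultimately show False
    using lev by (simp add: snd_rep_glue_class_eq_0_iff)
qed

lemma openin_limit_stage_finite_coords:
  assumes U: "openin (stage_space (limit_stage I S)) U" and x: "x \<in> threads I S" "Thread x \<in> U"
  shows "\<exists>F. finite F \<and> (\<forall>w\<in>threads I S. (\<forall>i\<in>F. w i = x i) \<longrightarrow> Thread w \<in> U)"
proof -
  let ?P = "product_topology (\<lambda>\<beta>. stage_space (S \<beta>)) I"
  have "openin (subtopology ?P (threads I S)) {z \<in> topspace (subtopology ?P (threads I S)). Thread z \<in> U}"
    using U unfolding limit_stage_def stage.simps openin_quotient_top by blast
  then obtain T where T: "openin ?P T"
    and eq: "{z \<in> topspace (subtopology ?P (threads I S)). Thread z \<in> U} = T \<inter> threads I S"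
    unfolding openin_subtopology by blast
  have mem: "z \<in> T \<longleftrightarrow> Thread z \<in> U" if "z \<in> threads I S" for z
    using eq that threads_subset[of I S] by (auto simp: topspace_subtopology)
  have "x \<in> T"
    using mem x by simp
  then obtain V where V: "finite {i \<in> I. V i \<noteq> topspace (stage_space (S i))}"
    "x \<in> PiE I V" "PiE I V \<subseteq> T"
    using T unfolding openin_product_topology_alt by metis
  show ?thesis
  proof (intro exI[of _ "{i \<in> I. V i \<noteq> topspace (stage_space (S i))}"] conjI V ballI impI)
    fix w
    assume w: "w \<in> threads I S" "\<forall>i\<in>{i \<in> I. V i \<noteq> topspace (stage_space (S i))}. w i = x i"
    have "w i \<in> V i" if "i \<in> I" for i
    proof (cases "V i = topspace (stage_space (S i))")
      case True
      then show ?thesis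
        using w(1) that by (auto simp: threads_def)
    next
      case False
      then have "w i = x i"
        using w(2) that by blast
      then show ?thesis
        using V(2) that by (auto simp: PiE_iff)
    qed
    moreover have "w \<in> extensional I"
      using w(1) by (auto simp: threads_def PiE_iff)
    ultimately have "w \<in> PiE I V"
      by (simp add: PiE_iff)
    then have "w \<in> T"
      using V(3) by blast
    then show "Thread w \<in> U"
      using mem w(1) by simp
  qed
qed

lemma countable_coords_if_metrizable:
  assumes metr: "metrizable_space (subtopology (stage_space (limit_stage I S)) Z)"
    and x: "x \<in> threads I S" "Thread x \<in> Z"
  shows "\<exists>C. countable C \<and> (\<forall>w\<in>threads I S. Thread w \<in> Z \<and> (\<forall>i\<in>C. w i = x i) \<longrightarrow> w = x)"
proof -
  let ?L = "stage_space (limit_stage I S)"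
  obtain M d where "Metric_space M d" and eq: "subtopology ?L Z = Metric_space.mtopology M d"
    using metr unfolding metrizable_space_def by blast
  then interpret Metric_space M d
    by simp
  have M: "M = topspace ?L \<inter> Z"
    using eq topspace_mtopology topspace_subtopology by metis
  have "\<exists>F. finite F \<and> (\<forall>w\<in>threads I S. Thread w \<in> Z \<and> (\<forall>i\<in>F. w i = x i) \<longrightarrow>
      Thread w \<in> mball (Thread x) (1 / real (Suc k)))" for k
  proof -
    have "openin (subtopology ?L Z) (mball (Thread x) (1 / real (Suc k)))"
      unfolding eq by simp
    then obtain U where U: "openin ?L U" "mball (Thread x) (1 / real (Suc k)) = U \<inter> Z"
      unfolding openin_subtopology by blast
    have "Thread x \<in> mball (Thread x) (1 / real (Suc k))"
      using x by (intro centre_in_mball_iff[THEN iffD2]) (auto simp: M topspace_limit_stage)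
    then have "Thread x \<in> U"
      using U(2) by blast
    then show ?thesis
      using openin_limit_stage_finite_coords[OF U(1) x(1)] unfolding U(2) by blast
  qed
  then obtain F where F: "\<And>k. finite (F k)" "\<And>k w. \<lbrakk>w \<in> threads I S; Thread w \<in> Z; \<forall>i\<in>F k. w i = x i\<rbrakk>
      \<Longrightarrow> Thread w \<in> mball (Thread x) (1 / real (Suc k))"
    by metis
  show ?thesis
  proof (intro exI[of _ "\<Union>k. F k"] conjI ballI impI)
    show "countable (\<Union>k. F k)"
      using F(1) by (intro countable_UN) (auto intro: countable_finite)
    fix w
    assume w: "w \<in> threads I S" "Thread w \<in> Z \<and> (\<forall>i\<in>\<Union>k. F k. w i = x i)"
    then have ball: "Thread w \<in> mball (Thread x) (1 / real (Suc k))" for k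
      using F(2) by blast
    have "d (Thread x) (Thread w) = 0"
    proof (rule ccontr)
      assume "d (Thread x) (Thread w) \<noteq> 0"
      then have "0 < d (Thread x) (Thread w)"
        using nonneg[of "Thread x" "Thread w"] by linarith
      then obtain k where "1 / real (Suc k) < d (Thread x) (Thread w)"
        using nat_approx_posE by blast
      then show False
        using ball[of k] by auto
    qed
    then show "w = x"
      using ball[of 0] by simp
  qed
qed

theorem claim19:
  fixes q0 :: "nat \<Rightarrow> real \<times> real"
  assumes "\<And>n. 1 \<le> n \<Longrightarrow> q0 n \<in> sin_graph"
    and "strict_mono_on {1..} (\<lambda>n. fst (q0 n))"
    and "(\<lambda>n. fst (q0 n)) \<longlonglongrightarrow> 0"
  shows "\<not> metrizable_space
           (subtopology (X_omega1 q0) (topspace (X_omega1 q0) - trivial_composant q0))"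
proof
  have q0: "\<forall>n\<ge>1. q0 n \<in> sin_graph"
    using assms(1) by blast
  let ?Z = "topspace (X_omega1 q0) - trivial_composant q0"
  have X: "X_omega1 q0 = stage_space (limit_stage UNIV (stage_at q0))"
    by (simp add: X_omega1_def final_stage_def)
  assume metr: "metrizable_space (subtopology (X_omega1 q0) ?Z)"
  obtain z0 where "z0 \<in> cont_interval (stage_space (zero_stage q0)) (stage_a (zero_stage q0)) (stage_q (zero_stage q0) 1)"
      "z0 \<noteq> stage_a (zero_stage q0)" "z0 \<noteq> stage_q (zero_stage q0) 1"
    using ex_interior_point_zero_stage[OF q0] by blast
  then have z0: "interior_at q0 \<alpha> 1 z0" if "\<forall>\<beta>. \<alpha> \<le> \<beta>" for \<alpha>
    unfolding interior_at_def stage_at_zero[OF that] by blast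
  define y where "y = lift_from q0 z0 (\<lambda>_. 1)"
  have y_lift: "is_lift q0 (\<lambda>_. 1) y"
    unfolding y_def by (rule is_lift_lift_from)
  have y_int: "interior_at q0 \<alpha> 1 (y \<alpha>)" for \<alpha>
  proof -
    have "interior_at q0 \<alpha> ((1 + 1) div 2) (y \<alpha>)"
    proof (rule lift_interior_at[OF q0, where m = "\<lambda>_. 1"])
      show "is_lift q0 (\<lambda>_. 1 / real 1) y"
        using y_lift by simp
      show "interior_at q0 \<alpha> ((1 + 1) div 2) (y \<alpha>)" if "\<forall>\<beta>. \<alpha> \<le> \<beta>" for \<alpha>
        using z0[OF that] by (simp add: y_def lift_from_zero[OF that])
      show "\<exists>\<mu><\<alpha>. \<forall>\<beta>. \<mu> \<le> \<beta> \<and> \<beta> < \<alpha> \<longrightarrow> (1 + 1) div 2 = (1 + 1) div (2 :: nat)" if "is_limit \<alpha>" for \<alpha>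
        using that by (simp add: is_limit_def)
    qed simp_all
    then show ?thesis
      by simp
  qed
  have in_Z: "s \<in> threads UNIV (stage_at q0) \<and> Thread s \<in> ?Z"
    if "is_lift q0 lev s" "\<And>\<alpha>. lev \<alpha> \<noteq> 0" "\<And>\<alpha>. interior_at q0 \<alpha> (n \<alpha>) (s \<alpha>)" for s lev n
  proof -
    have "s \<alpha> \<in> topspace (space_at q0 \<alpha>)" for \<alpha>
      using that(3)[of \<alpha>] by (simp add: interior_at_def cont_interval_def)
    then show ?thesis
      using lift_in_threads[OF that(1)] lift_notin_trivial_composant[OF that(1,2)]
      by (simp add: X topspace_limit_stage)
  qed
  have yZ: "y \<in> threads UNIV (stage_at q0)" "Thread y \<in> ?Z"
    using in_Z[OF y_lift _ y_int] by simp_all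
  obtain C where C: "countable C"
    and unique: "\<forall>w\<in>threads UNIV (stage_at q0). Thread w \<in> ?Z \<and> (\<forall>\<alpha>\<in>C. w \<alpha> = y \<alpha>) \<longrightarrow> w = y"
    using countable_coords_if_metrizable[OF metr[unfolded X] yZ[unfolded X]] unfolding X by blast
  obtain \<delta> where \<delta>: "\<forall>\<alpha>\<in>C. \<alpha> \<le> \<delta>"
    using countable_bounded[OF C] by blast
  \<comment> \<open>Level \<open>1/2\<close> runs back to \<open>a\<close>, so from then on the point lies beyond \<open>q\<^sup>1\<close>, in \<open>[a, q\<^sup>2]\<close>, whose first
    copy is level \<open>1/3\<close>.\<close>
  define m :: "omega1 \<Rightarrow> nat" where "m \<alpha> = (if \<alpha> < \<delta> then 1 else if \<alpha> = \<delta> then 2 else 3)" for \<alpha>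
  define w where "w = lift_from q0 z0 (\<lambda>\<alpha>. 1 / real (m \<alpha>))"
  have w_lift: "is_lift q0 (\<lambda>\<alpha>. 1 / real (m \<alpha>)) w"
    unfolding w_def by (rule is_lift_lift_from)
  have w_eq_y: "w \<alpha> = y \<alpha>" if "\<alpha> \<le> \<delta>" for \<alpha>
    unfolding w_def y_def using that by (intro lift_from_cong) (auto simp: m_def)
  have w_int: "interior_at q0 \<alpha> ((m \<alpha> + 1) div 2) (w \<alpha>)" for \<alpha>
  proof (rule lift_interior_at[OF q0 w_lift])
    show "1 \<le> m \<alpha>" for \<alpha>
      by (simp add: m_def)
    show "interior_at q0 \<alpha> ((m \<alpha> + 1) div 2) (w \<alpha>)" if "\<forall>\<beta>. \<alpha> \<le> \<beta>" for \<alpha>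
    proof -
      have "(m \<alpha> + 1) div 2 = 1"
        using that[rule_format, of \<delta>] by (auto simp: m_def)
      then show ?thesis
        using z0[OF that] by (simp add: w_def lift_from_zero[OF that])
    qed
    show "(m \<alpha> + 1) div 2 = (m \<beta> + 2) div 2" if "is_succ \<beta> \<alpha>" for \<alpha> \<beta>
      using that by (cases \<beta> \<delta> rule: linorder_cases) (auto simp: m_def is_succ_def)
    show "\<exists>\<mu><\<alpha>. \<forall>\<beta>. \<mu> \<le> \<beta> \<and> \<beta> < \<alpha> \<longrightarrow> (m \<beta> + 1) div 2 = (m \<alpha> + 1) div 2"
      if lim: "is_limit \<alpha>" for \<alpha>
    proof (cases "\<delta> < \<alpha>")
      case True
      obtain \<mu> where "\<delta> < \<mu>" "\<mu> < \<alpha>"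
        using is_limit_dense[OF lim True] by blast
      then show ?thesis
        using True by (intro exI[of _ \<mu>]) (auto simp: m_def)
    next
      case False
      obtain \<mu> where "\<mu> < \<alpha>"
        using lim by (auto simp: is_limit_def)
      then show ?thesis
        using False by (intro exI[of _ \<mu>]) (auto simp: m_def)
    qed
  qed
  have wZ: "w \<in> threads UNIV (stage_at q0)" "Thread w \<in> ?Z"
    using in_Z[OF w_lift _ w_int] by (simp_all add: m_def)
  have "w = y"
    using unique wZ \<delta> w_eq_y by blast
  obtain \<alpha> where \<alpha>: "is_succ \<delta> \<alpha>"
    using ex_is_succ by blast
  have "y \<alpha> = glue_class (a_at q0 \<delta>) (q_at q0 \<delta>) (y \<delta>, 1)"
    using y_lift \<alpha> by (simp add: is_lift_def)
  moreover have "w \<alpha> = glue_class (a_at q0 \<delta>) (q_at q0 \<delta>) (y \<delta>, 1 / 2)"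
    using w_lift \<alpha> w_eq_y[of \<delta>] by (simp add: is_lift_def m_def)
  moreover have "y \<delta> \<noteq> q_at q0 \<delta> 1"
    using y_int by (simp add: interior_at_def)
  ultimately show False
    using marked_space.cls_levels_1_2_neq[OF marked_space_stage[OF q0]] \<open>w = y\<close> by metis
qed

end
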